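(* Let $I$ be a finitely generated graded $T$-ideal, $k/F$ a field extension, and $B=(V_k,\mu)$ a finite-dimensional unital graded $k$-algebra satisfying $I$ (a $k$-point of the law scheme $\mathrm{Alg}^G_{\mathbf d}(I)$). For $\varphi\in Z^2_{G,I,\mathrm n}(B,B)$, the following conditions are equivalent. (1) The first-order deformation $\mu+t\varphi$ over $k[t]/(t^2)$ lifts to an $I$-preserving unital graded (associative) multiplication over $k[t]/(t^3)$. (2) There exists $\psi\in C^2_{G,\mathrm n}(B,B)$ satisfying $\partial_\mu\psi=-Q_{\mathrm{ass}}(\varphi)$ and $D_\mu f_j(\psi)=-Q_j(\varphi)$ for $1\le j\le r$. (3) $\mathrm{ob}^{(2)}_{I,B}(\varphi)=0$. The cokernel in which $\mathrm{ob}^{(2)}_{I,B}(\varphi)$ lives depends on the chosen generators $f_1,\dots,f_r$ of $I$. Its zero condition does not: it is equivalent to liftability, hence is independent of the generating system and invariant under isomorphisms of first-order deformations.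
   Context: $F$ is a field of characteristic zero and $G$ is a finite group with neutral element $e$. Algebras are associative and unital. $F\langle X\mid G\rangle$ is the free associative algebra on variables $x_i^g$ of degree $g\in G$; a graded $T$-ideal is an ideal of it stable under all graded endomorphisms; a $G$-graded algebra satisfies $I$ if every degree-preserving evaluation of every $f\in I$ vanishes. For a dimension vector $\mathbf d=(d_g)$ with $d_e\ge1$, fix graded vector spaces $V=\bigoplus V_g$, $\dim_F V_g=d_g$, with a nonzero vector $\mathbf1\in V_e$; $\mathrm{Alg}^G_{\mathbf d}(I)$ is the affine scheme of associative graded multiplications on $V$ with unit $\mathbf1$ satisfying $I$. $C^n_{G,\mathrm n}(B,B)$ is the space of degree-preserving $k$-multilinear maps $B^{\otimes n}\to B$ vanishing when some argument is $1$. For $\psi\in C^2_{G,\mathrm n}(B,B)$, $\partial_\mu\psi(x,y,z)=d_{\mathrm{Hoch}}\psi(x,y,z)=\psi(xy,z)-\psi(x,yz)+\psi(x,y)z-x\psi(y,z)$. Fix finitely many multilinear graded $T$-generators $f_1,\dots,f_r$ of $I$, $f_j$ in $m_j$ variables, and fix bracketings of their monomials, so that evaluation of $f_j$ is a polynomial function of an arbitrary (not necessarily associative) multiplication law. $D_\mu f_j(\psi)$ is its first differential at $\mu$ in direction $\psi$: $f_{j,\mu+\varepsilon\psi}=\varepsilon D_\mu f_j(\psi)$ with $\varepsilon^2=0$ (similarly for any $f\in I$). $Z^2_{G,I,\mathrm n}(B,B)=\{\varphi\in C^2_{G,\mathrm n}(B,B):d_{\mathrm{Hoch}}\varphi=0,\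 D_\mu f(\varphi)=0\ \forall f\in I\}$. A second-order lift of $\mu+t\varphi$ is a multiplication $\mu+t\varphi+t^2\psi$ on $B\otimes_kk[t]/(t^3)$, $\psi\in C^2_{G,\mathrm n}(B,B)$, that is associative, unital, graded, satisfies $I$, and reduces to $\mu+t\varphi$ over $k[t]/(t^2)$. Put $Q_{\mathrm{ass}}(\varphi)(x,y,z)=\varphi(\varphi(x,y),z)-\varphi(x,\varphi(y,z))$ and $Q_j(\varphi)=\frac12D_\mu^2f_j(\varphi,\varphi)$ (the coefficient of $t^2$ in the evaluation of $f_j$ using $\mu+t\varphi$). Define the linear operator $\mathcal L_{I,B}:C^2_{G,\mathrm n}(B,B)\to C^3_{G,\mathrm n}(B,B)\oplus\bigoplus_{j=1}^r\operatorname{Hom}_k(B^{\otimes m_j},B)$ by $\mathcal L_{I,B}(\psi)=(\partial_\mu\psi,D_\mu f_1(\psi),\dots,D_\mu f_r(\psi))$, and $\mathrm{ob}^{(2)}_{I,B}(\varphi)=[Q_{\mathrm{ass}}(\varphi),Q_1(\varphi),\dots,Q_r(\varphi)]\in\operatorname{coker}\mathcal L_{I,B}$. Isomorphisms of first-order deformations are graded algebra isomorphisms over $k[t]/(t^2)$ reducing to the identity modulo $t$. *)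

theory Defs
  imports
    Complex_Main
    "HOL-Library.Poly_Mapping"
    "HOL-Library.Function_Algebras"
    "HOL-Library.Product_Plus"
    "HOL-Library.Set_Algebras"
    "HOL-Library.Multiset"
begin

section \<open>The free graded algebra and graded T-ideals\<close>

text \<open>
  The grading group is a type of class \<^class>\<open>group_add\<close>, which is not assumed commutative:
  the group law is written \<open>+\<close> and the neutral element \<open>0\<close>.  The variable \<open>x\<^sub>i\<^sup>g\<close> is the pair
  \<open>(i, g)\<close>.  Words form the free monoid (written additively), so finitely supported functions on
  words with the convolution product are the free associative unital algebra.
\<close>

instantiation list :: (type) monoid_add
begin
definition zero_list :: "'a list" where "zero_list = []"
definition plus_list :: "'a list \<Rightarrow> 'a list \<Rightarrow> 'a list" where "plus_list = (@)"
instance by standard (simp_all add: zero_list_def plus_list_def)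
end

type_synonym 'g word = "(nat \<times> 'g) list"
type_synonym ('g, 'f) free_alg = "'g word \<Rightarrow>\<^sub>0 'f"

definition homogeneous :: "'g::group_add \<Rightarrow> ('g, 'f::field) free_alg set" where
  "homogeneous g = {p. \<forall>w\<in>Poly_Mapping.keys p. sum_list (map snd w) = g}"

definition graded_endo :: "(('g::group_add, 'f::field) free_alg \<Rightarrow> ('g, 'f) free_alg) \<Rightarrow> bool" where
  "graded_endo \<Phi> \<longleftrightarrow>
     \<Phi> 1 = 1 \<and>
     (\<forall>p q. \<Phi> (p + q) = \<Phi> p + \<Phi> q) \<and>
     (\<forall>p q. \<Phi> (p * q) = \<Phi> p * \<Phi> q) \<and>
     (\<forall>c p. \<Phi> (Poly_Mapping.single 0 c * p) = Poly_Mapping.single 0 c * \<Phi> p) \<and>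
     (\<forall>g. \<Phi> ` homogeneous g \<subseteq> homogeneous g)"

definition graded_T_ideal :: "('g::group_add, 'f::field) free_alg set \<Rightarrow> bool" where
  "graded_T_ideal I \<longleftrightarrow>
     0 \<in> I \<and>
     (\<forall>p\<in>I. \<forall>q\<in>I. p + q \<in> I) \<and>
     (\<forall>p\<in>I. \<forall>q. q * p \<in> I \<and> p * q \<in> I) \<and>
     (\<forall>\<Phi>. graded_endo \<Phi> \<longrightarrow> \<Phi> ` I \<subseteq> I)"

text \<open>
  A generator comes with the ordered list of the (distinct) variables in which it is multilinear.
\<close>

type_synonym ('g, 'f) generator = "(nat \<times> 'g) list \<times> ('g, 'f) free_alg"

definition multilinear_generator :: "('g, 'f::field) generator \<Rightarrow> bool" where
  "multilinear_generator F \<longleftrightarrow>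
     distinct (fst F) \<and> (\<forall>w\<in>Poly_Mapping.keys (snd F). mset w = mset (fst F))"

definition generating_system ::
  "('g::group_add, 'f::field) free_alg set \<Rightarrow> ('g, 'f) generator list \<Rightarrow> bool" where
  "generating_system I gens \<longleftrightarrow>
     (\<forall>F\<in>set gens. multilinear_generator F) \<and> I = graded_T_ideal hull (snd ` set gens)"

definition field_embedding :: "('f::field \<Rightarrow> 'k::field) \<Rightarrow> bool" where
  "field_embedding \<iota> \<longleftrightarrow>
     \<iota> 1 = 1 \<and> (\<forall>x y. \<iota> (x + y) = \<iota> x + \<iota> y) \<and> (\<forall>x y. \<iota> (x * y) = \<iota> x * \<iota> y)"


section \<open>Evaluation of polynomials\<close>

text \<open>
  \<open>s\<close> is the action of the coefficients, \<open>u\<close> the unit and \<open>M\<close> the multiplication.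
\<close>

definition assoc_eval ::
  "('f::field \<Rightarrow> 'w::ab_group_add \<Rightarrow> 'w) \<Rightarrow> 'w \<Rightarrow> ('w \<Rightarrow> 'w \<Rightarrow> 'w) \<Rightarrow>
   ('g, 'f) free_alg \<Rightarrow> (nat \<times> 'g \<Rightarrow> 'w) \<Rightarrow> 'w" where
  "assoc_eval s u M f a = (\<Sum>w\<in>Poly_Mapping.keys f. s (Poly_Mapping.lookup f w) (foldr M (map a w) u))"

definition graded_assignment :: "('g \<Rightarrow> 'w set) \<Rightarrow> (nat \<times> 'g \<Rightarrow> 'w) \<Rightarrow> bool" where
  "graded_assignment W a \<longleftrightarrow> (\<forall>i g. a (i, g) \<in> W g)"

definition satisfies ::
  "('f::field \<Rightarrow> 'w::ab_group_add \<Rightarrow> 'w) \<Rightarrow> ('g \<Rightarrow> 'w set) \<Rightarrow> 'w \<Rightarrow> ('w \<Rightarrow> 'w \<Rightarrow> 'w) \<Rightarrow>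
   ('g, 'f) free_alg set \<Rightarrow> bool" where
  "satisfies s W u M I \<longleftrightarrow>
     (\<forall>f\<in>I. \<forall>a. graded_assignment W a \<longrightarrow> assoc_eval s u M f a = 0)"

datatype 'x bracketed = Var 'x | Mul "'x bracketed" "'x bracketed"

fun leaves :: "'x bracketed \<Rightarrow> 'x list" where
  "leaves (Var x) = [x]"
| "leaves (Mul l r) = leaves l @ leaves r"

fun bracketed_eval :: "('w \<Rightarrow> 'w \<Rightarrow> 'w) \<Rightarrow> ('x \<Rightarrow> 'w) \<Rightarrow> 'x bracketed \<Rightarrow> 'w" where
  "bracketed_eval M a (Var x) = a x"
| "bracketed_eval M a (Mul l r) = M (bracketed_eval M a l) (bracketed_eval M a r)"

text \<open>
  \<open>\<beta> f w\<close> is the bracketing chosen for the monomial \<open>w\<close> of \<open>f\<close>.  The empty monomial needs no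
  bracketing; it evaluates to the unit.
\<close>

definition bracketing :: "(('g, 'f::field) free_alg \<Rightarrow> 'g word \<Rightarrow> (nat \<times> 'g) bracketed) \<Rightarrow> bool" where
  "bracketing \<beta> \<longleftrightarrow> (\<forall>f w. w \<noteq> [] \<longrightarrow> leaves (\<beta> f w) = w)"

definition law_eval ::
  "('f::field \<Rightarrow> 'w::ab_group_add \<Rightarrow> 'w) \<Rightarrow> 'w \<Rightarrow> ('w \<Rightarrow> 'w \<Rightarrow> 'w) \<Rightarrow>
   (('g, 'f) free_alg \<Rightarrow> 'g word \<Rightarrow> (nat \<times> 'g) bracketed) \<Rightarrow>
   ('g, 'f) free_alg \<Rightarrow> (nat \<times> 'g \<Rightarrow> 'w) \<Rightarrow> 'w" where
  "law_eval s u M \<beta> f a =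
     (\<Sum>w\<in>Poly_Mapping.keys f. s (Poly_Mapping.lookup f w) (if w = [] then u else bracketed_eval M a (\<beta> f w)))"


section \<open>Graded spaces, graded algebras and cochains\<close>

record ('g, 'k, 'v) gspace =
  gscale :: "'k \<Rightarrow> 'v \<Rightarrow> 'v"
  gcomp :: "'g \<Rightarrow> 'v set"
  gunit :: "'v"

definition graded_space :: "('g::{group_add,finite}, 'k::field, 'v::ab_group_add) gspace \<Rightarrow> bool" where
  "graded_space B \<longleftrightarrow>
     vector_space (gscale B) \<and>
     (\<exists>S. finite S \<and> module.span (gscale B) S = UNIV) \<and>
     (\<forall>g. module.subspace (gscale B) (gcomp B g)) \<and>
     (\<forall>x. \<exists>!c. (\<forall>g. c g \<in> gcomp B g) \<and> x = (\<Sum>g\<in>UNIV. c g)) \<and>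
     gunit B \<in> gcomp B 0 \<and> gunit B \<noteq> 0"

definition gproj :: "('g::{group_add,finite}, 'k::field, 'v::ab_group_add) gspace \<Rightarrow> 'g \<Rightarrow> 'v \<Rightarrow> 'v" where
  "gproj B g x = (THE c. (\<forall>h. c h \<in> gcomp B h) \<and> x = (\<Sum>h\<in>UNIV. c h)) g"

definition unital_graded_mult ::
  "'w set \<Rightarrow> ('g::group_add \<Rightarrow> 'w set) \<Rightarrow> 'w \<Rightarrow> ('w \<Rightarrow> 'w \<Rightarrow> 'w) \<Rightarrow> bool" where
  "unital_graded_mult S W u M \<longleftrightarrow>
     (\<forall>x\<in>S. \<forall>y\<in>S. M x y \<in> S) \<and>
     (\<forall>x\<in>S. \<forall>y\<in>S. \<forall>z\<in>S. M (M x y) z = M x (M y z)) \<and>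
     u \<in> S \<and> (\<forall>x\<in>S. M u x = x \<and> M x u = x) \<and>
     u \<in> W 0 \<and> (\<forall>g h. \<forall>x\<in>W g. \<forall>y\<in>W h. M x y \<in> W (g + h))"

definition graded_algebra ::
  "('g::{group_add,finite}, 'k::field, 'v::ab_group_add) gspace \<Rightarrow> ('v \<Rightarrow> 'v \<Rightarrow> 'v) \<Rightarrow> bool" where
  "graded_algebra B \<mu> \<longleftrightarrow>
     graded_space B \<and>
     (\<forall>x. Vector_Spaces.linear (gscale B) (gscale B) (\<lambda>y. \<mu> x y)) \<and>
     (\<forall>y. Vector_Spaces.linear (gscale B) (gscale B) (\<lambda>x. \<mu> x y)) \<and>
     unital_graded_mult UNIV (gcomp B) (gunit B) \<mu>"

text \<open>
  A linear map \<open>B\<^sup>\<otimes>\<^sup>n \<rightarrow> B\<close> is given by a multilinear function of argument lists of length \<open>n\<close>; its value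
  on other lists is fixed to \<open>0\<close>, so that equality of functions is equality of maps.
\<close>

definition multilinear_maps ::
  "('g, 'k::field, 'v::ab_group_add) gspace \<Rightarrow> nat \<Rightarrow> ('v list \<Rightarrow> 'v) set" where
  "multilinear_maps B n =
     {h. (\<forall>xs. length xs \<noteq> n \<longrightarrow> h xs = 0) \<and>
         (\<forall>xs i. length xs = n \<and> i < n \<longrightarrow>
            Vector_Spaces.linear (gscale B) (gscale B) (\<lambda>x. h (xs[i := x])))}"

definition cochains ::
  "('g::group_add, 'k::field, 'v::ab_group_add) gspace \<Rightarrow> nat \<Rightarrow> ('v list \<Rightarrow> 'v) set" where
  "cochains B n =
     {h \<in> multilinear_maps B n.
        (\<forall>gs xs. length xs = n \<and> list_all2 (\<lambda>g x. x \<in> gcomp B g) gs xs \<longrightarrow>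
           h xs \<in> gcomp B (sum_list gs)) \<and>
        (\<forall>xs. length xs = n \<and> gunit B \<in> set xs \<longrightarrow> h xs = 0)}"

abbreviation binary :: "('v list \<Rightarrow> 'v) \<Rightarrow> 'v \<Rightarrow> 'v \<Rightarrow> 'v" where
  "binary h \<equiv> (\<lambda>x y. h [x, y])"

definition d_Hoch :: "('v::ab_group_add \<Rightarrow> 'v \<Rightarrow> 'v) \<Rightarrow> ('v list \<Rightarrow> 'v) \<Rightarrow> 'v list \<Rightarrow> 'v" where
  "d_Hoch \<mu> \<psi> xs = (case xs of
       [x, y, z] \<Rightarrow> \<psi> [\<mu> x y, z] - \<psi> [x, \<mu> y z] + \<mu> (\<psi> [x, y]) z - \<mu> x (\<psi> [y, z])
     | _ \<Rightarrow> 0)"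

definition Q_ass :: "('v::ab_group_add list \<Rightarrow> 'v) \<Rightarrow> 'v list \<Rightarrow> 'v" where
  "Q_ass \<phi> xs = (case xs of
       [x, y, z] \<Rightarrow> \<phi> [\<phi> [x, y], z] - \<phi> [x, \<phi> [y, z]]
     | _ \<Rightarrow> 0)"


section \<open>Laws over truncated polynomial rings\<close>

text \<open>
  An element of \<open>B \<otimes> k[t]/(t\<^sup>n)\<close> is its sequence of coefficients, zero from index \<open>n\<close> on.  The law
  \<open>\<Sum>\<^sub>p t\<^sup>p m\<^sub>p\<close>, with the \<open>m\<^sub>p\<close> listed in \<open>ms\<close>, is extended \<open>k[t]/(t\<^sup>n)\<close>-bilinearly.
\<close>

definition tspace :: "nat \<Rightarrow> (nat \<Rightarrow> 'v::ab_group_add) set" where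
  "tspace n = {a. \<forall>i\<ge>n. a i = 0}"

definition tcomp ::
  "('g, 'k, 'v::ab_group_add) gspace \<Rightarrow> nat \<Rightarrow> 'g \<Rightarrow> (nat \<Rightarrow> 'v) set" where
  "tcomp B n g = {a \<in> tspace n. \<forall>i<n. a i \<in> gcomp B g}"

definition tconst :: "'v::ab_group_add \<Rightarrow> nat \<Rightarrow> 'v" where
  "tconst x = (\<lambda>i. if i = 0 then x else 0)"

definition tcut :: "nat \<Rightarrow> (nat \<Rightarrow> 'v::ab_group_add) \<Rightarrow> nat \<Rightarrow> 'v" where
  "tcut n a = (\<lambda>i. if i < n then a i else 0)"

definition tshift :: "nat \<Rightarrow> (nat \<Rightarrow> 'v::ab_group_add) \<Rightarrow> nat \<Rightarrow> 'v" where
  "tshift n a = (\<lambda>i. if 0 < i \<and> i < n then a (i - 1) else 0)"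

definition tscale :: "('g, 'k, 'v) gspace \<Rightarrow> 'k \<Rightarrow> (nat \<Rightarrow> 'v) \<Rightarrow> nat \<Rightarrow> 'v" where
  "tscale B c a = (\<lambda>i. gscale B c (a i))"

definition tlaw ::
  "nat \<Rightarrow> ('v::ab_group_add \<Rightarrow> 'v \<Rightarrow> 'v) list \<Rightarrow> (nat \<Rightarrow> 'v) \<Rightarrow> (nat \<Rightarrow> 'v) \<Rightarrow> nat \<Rightarrow> 'v" where
  "tlaw n ms a b = (\<lambda>l. if l < n
     then \<Sum>(p, i, j)\<in>{(p, i, j). p < length ms \<and> p + i + j = l}. (ms ! p) (a i) (b j)
     else 0)"

text \<open>
  The polynomials are evaluated at arguments in \<open>B\<close>.  The first differential in direction \<open>\<psi>\<close> is
  the coefficient of \<open>t\<close> for the law \<open>\<mu> + t \<psi>\<close>; half the second differential is the coefficient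
  of \<open>t\<^sup>2\<close> for the law \<open>\<mu> + t \<phi>\<close>.
\<close>

definition tlaw_eval ::
  "('f::field \<Rightarrow> 'k::field) \<Rightarrow> ('g, 'k, 'v::ab_group_add) gspace \<Rightarrow> nat \<Rightarrow> ('v \<Rightarrow> 'v \<Rightarrow> 'v) list \<Rightarrow>
   (('g, 'f) free_alg \<Rightarrow> 'g word \<Rightarrow> (nat \<times> 'g) bracketed) \<Rightarrow>
   ('g, 'f) free_alg \<Rightarrow> (nat \<times> 'g \<Rightarrow> 'v) \<Rightarrow> nat \<Rightarrow> 'v" where
  "tlaw_eval \<iota> B n ms \<beta> f a =
     law_eval (\<lambda>c. tscale B (\<iota> c)) (tconst (gunit B)) (tlaw n ms) \<beta> f (\<lambda>x. tconst (a x))"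

definition D_law ::
  "('f::field \<Rightarrow> 'k::field) \<Rightarrow> ('g, 'k, 'v::ab_group_add) gspace \<Rightarrow> ('v \<Rightarrow> 'v \<Rightarrow> 'v) \<Rightarrow>
   (('g, 'f) free_alg \<Rightarrow> 'g word \<Rightarrow> (nat \<times> 'g) bracketed) \<Rightarrow>
   ('g, 'f) free_alg \<Rightarrow> ('v list \<Rightarrow> 'v) \<Rightarrow> (nat \<times> 'g \<Rightarrow> 'v) \<Rightarrow> 'v" where
  "D_law \<iota> B \<mu> \<beta> f \<psi> a = tlaw_eval \<iota> B 2 [\<mu>, binary \<psi>] \<beta> f a 1"

definition Q_law ::
  "('f::field \<Rightarrow> 'k::field) \<Rightarrow> ('g, 'k, 'v::ab_group_add) gspace \<Rightarrow> ('v \<Rightarrow> 'v \<Rightarrow> 'v) \<Rightarrow>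
   (('g, 'f) free_alg \<Rightarrow> 'g word \<Rightarrow> (nat \<times> 'g) bracketed) \<Rightarrow>
   ('g, 'f) free_alg \<Rightarrow> ('v list \<Rightarrow> 'v) \<Rightarrow> (nat \<times> 'g \<Rightarrow> 'v) \<Rightarrow> 'v" where
  "Q_law \<iota> B \<mu> \<beta> f \<phi> a = tlaw_eval \<iota> B 3 [\<mu>, binary \<phi>] \<beta> f a 2"

definition Z2 ::
  "('f::field \<Rightarrow> 'k::field) \<Rightarrow> ('g::group_add, 'k, 'v::ab_group_add) gspace \<Rightarrow> ('v \<Rightarrow> 'v \<Rightarrow> 'v) \<Rightarrow>
   (('g, 'f) free_alg \<Rightarrow> 'g word \<Rightarrow> (nat \<times> 'g) bracketed) \<Rightarrow>
   ('g, 'f) free_alg set \<Rightarrow> ('v list \<Rightarrow> 'v) set" where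
  "Z2 \<iota> B \<mu> \<beta> I =
     {\<phi> \<in> cochains B 2. d_Hoch \<mu> \<phi> = 0 \<and>
        (\<forall>f\<in>I. \<forall>a. graded_assignment (gcomp B) a \<longrightarrow> D_law \<iota> B \<mu> \<beta> f \<phi> a = 0)}"

definition second_order_lift ::
  "('f::field \<Rightarrow> 'k::field) \<Rightarrow> ('g::group_add, 'k, 'v::ab_group_add) gspace \<Rightarrow> ('v \<Rightarrow> 'v \<Rightarrow> 'v) \<Rightarrow>
   ('g, 'f) free_alg set \<Rightarrow> ('v list \<Rightarrow> 'v) \<Rightarrow> ((nat \<Rightarrow> 'v) \<Rightarrow> (nat \<Rightarrow> 'v) \<Rightarrow> nat \<Rightarrow> 'v) \<Rightarrow> bool" where
  "second_order_lift \<iota> B \<mu> I \<phi> M \<longleftrightarrow>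
     (\<exists>\<psi>\<in>cochains B 2. M = tlaw 3 [\<mu>, binary \<phi>, binary \<psi>]) \<and>
     unital_graded_mult (tspace 3) (tcomp B 3) (tconst (gunit B)) M \<and>
     satisfies (\<lambda>c. tscale B (\<iota> c)) (tcomp B 3) (tconst (gunit B)) M I \<and>
     (\<forall>a\<in>tspace 3. \<forall>b\<in>tspace 3.
        tcut 2 (M a b) = tlaw 2 [\<mu>, binary \<phi>] (tcut 2 a) (tcut 2 b))"

definition first_order_iso ::
  "('g::group_add, 'k::field, 'v::ab_group_add) gspace \<Rightarrow> ('v \<Rightarrow> 'v \<Rightarrow> 'v) \<Rightarrow>
   ('v list \<Rightarrow> 'v) \<Rightarrow> ('v list \<Rightarrow> 'v) \<Rightarrow> ((nat \<Rightarrow> 'v) \<Rightarrow> nat \<Rightarrow> 'v) \<Rightarrow> bool" where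
  "first_order_iso B \<mu> \<phi> \<phi>' \<Theta> \<longleftrightarrow>
     bij_betw \<Theta> (tspace 2) (tspace 2) \<and>
     (\<forall>a\<in>tspace 2. \<forall>b\<in>tspace 2. \<Theta> (a + b) = \<Theta> a + \<Theta> b) \<and>
     (\<forall>c. \<forall>a\<in>tspace 2. \<Theta> (tscale B c a) = tscale B c (\<Theta> a)) \<and>
     (\<forall>a\<in>tspace 2. \<Theta> (tshift 2 a) = tshift 2 (\<Theta> a)) \<and>
     (\<forall>g. \<Theta> ` tcomp B 2 g \<subseteq> tcomp B 2 g) \<and>
     \<Theta> (tconst (gunit B)) = tconst (gunit B) \<and>
     (\<forall>a\<in>tspace 2. \<forall>b\<in>tspace 2.
        \<Theta> (tlaw 2 [\<mu>, binary \<phi>] a b) = tlaw 2 [\<mu>, binary \<phi>'] (\<Theta> a) (\<Theta> b)) \<and>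
     (\<forall>a\<in>tspace 2. tcut 1 (\<Theta> a) = tcut 1 a)"


section \<open>The obstruction class\<close>

text \<open>
  Only arguments of the prescribed degrees may be substituted into a graded polynomial.  The map
  \<open>B\<^bsub>g\<^sub>1\<^esub> \<otimes> \<dots> \<otimes> B\<^bsub>g\<^sub>m\<^esub> \<rightarrow> B\<close> so obtained from a generator is regarded as an element of
  \<open>Hom(B\<^sup>\<otimes>\<^sup>m, B)\<close> by projecting every argument to the component of its variable, i.e. it is extended
  by zero to the other components of \<open>B\<^sup>\<otimes>\<^sup>m\<close>.
\<close>

definition arg_assignment ::
  "('g::{group_add,finite}, 'k::field, 'v::ab_group_add) gspace \<Rightarrow> (nat \<times> 'g) list \<Rightarrow> 'v list \<Rightarrow>
   nat \<times> 'g \<Rightarrow> 'v" where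
  "arg_assignment B vs bs x =
     (case map_of (zip vs bs) x of Some b \<Rightarrow> gproj B (snd x) b | None \<Rightarrow> 0)"

definition hom_of ::
  "('g::{group_add,finite}, 'k::field, 'v::ab_group_add) gspace \<Rightarrow> (nat \<times> 'g) list \<Rightarrow>
   ((nat \<times> 'g \<Rightarrow> 'v) \<Rightarrow> 'v) \<Rightarrow> 'v list \<Rightarrow> 'v" where
  "hom_of B vs E bs = (if length bs = length vs then E (arg_assignment B vs bs) else 0)"

definition D_gen ::
  "('f::field \<Rightarrow> 'k::field) \<Rightarrow> ('g::{group_add,finite}, 'k, 'v::ab_group_add) gspace \<Rightarrow>
   ('v \<Rightarrow> 'v \<Rightarrow> 'v) \<Rightarrow> (('g, 'f) free_alg \<Rightarrow> 'g word \<Rightarrow> (nat \<times> 'g) bracketed) \<Rightarrow>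
   ('g, 'f) generator \<Rightarrow> ('v list \<Rightarrow> 'v) \<Rightarrow> 'v list \<Rightarrow> 'v" where
  "D_gen \<iota> B \<mu> \<beta> F \<psi> = hom_of B (fst F) (D_law \<iota> B \<mu> \<beta> (snd F) \<psi>)"

definition Q_gen ::
  "('f::field \<Rightarrow> 'k::field) \<Rightarrow> ('g::{group_add,finite}, 'k, 'v::ab_group_add) gspace \<Rightarrow>
   ('v \<Rightarrow> 'v \<Rightarrow> 'v) \<Rightarrow> (('g, 'f) free_alg \<Rightarrow> 'g word \<Rightarrow> (nat \<times> 'g) bracketed) \<Rightarrow>
   ('g, 'f) generator \<Rightarrow> ('v list \<Rightarrow> 'v) \<Rightarrow> 'v list \<Rightarrow> 'v" where
  "Q_gen \<iota> B \<mu> \<beta> F \<phi> = hom_of B (fst F) (Q_law \<iota> B \<mu> \<beta> (snd F) \<phi>)"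

text \<open>
  An element of \<open>C\<^sup>3 \<oplus> \<Oplus>\<^sub>j Hom(B\<^sup>\<otimes>\<^sup>m\<^sup>j, B)\<close> is a pair whose second part is a family indexed by \<open>j\<close>
  (counted from \<open>0\<close>), zero beyond the number of generators.
\<close>

type_synonym 'v target = "('v list \<Rightarrow> 'v) \<times> (nat \<Rightarrow> 'v list \<Rightarrow> 'v)"

definition target_space ::
  "('g::group_add, 'k::field, 'v::ab_group_add) gspace \<Rightarrow> ('g, 'f::field) generator list \<Rightarrow>
   'v target set" where
  "target_space B gens =
     {(c, h). c \<in> cochains B 3 \<and>
        (\<forall>j<length gens. h j \<in> multilinear_maps B (length (fst (gens ! j)))) \<and>
        (\<forall>j\<ge>length gens. h j = 0)}"

definition target_scale :: "('g, 'k, 'v) gspace \<Rightarrow> 'k \<Rightarrow> 'v target \<Rightarrow> 'v target" where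
  "target_scale B c q = (\<lambda>xs. gscale B c (fst q xs), \<lambda>j xs. gscale B c (snd q j xs))"

definition L_op ::
  "('f::field \<Rightarrow> 'k::field) \<Rightarrow> ('g::{group_add,finite}, 'k, 'v::ab_group_add) gspace \<Rightarrow>
   ('v \<Rightarrow> 'v \<Rightarrow> 'v) \<Rightarrow> (('g, 'f) free_alg \<Rightarrow> 'g word \<Rightarrow> (nat \<times> 'g) bracketed) \<Rightarrow>
   ('g, 'f) generator list \<Rightarrow> ('v list \<Rightarrow> 'v) \<Rightarrow> 'v target" where
  "L_op \<iota> B \<mu> \<beta> gens \<psi> =
     (d_Hoch \<mu> \<psi>, \<lambda>j. if j < length gens then D_gen \<iota> B \<mu> \<beta> (gens ! j) \<psi> else 0)"

definition L_image ::
  "('f::field \<Rightarrow> 'k::field) \<Rightarrow> ('g::{group_add,finite}, 'k, 'v::ab_group_add) gspace \<Rightarrow>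
   ('v \<Rightarrow> 'v \<Rightarrow> 'v) \<Rightarrow> (('g, 'f) free_alg \<Rightarrow> 'g word \<Rightarrow> (nat \<times> 'g) bracketed) \<Rightarrow>
   ('g, 'f) generator list \<Rightarrow> 'v target set" where
  "L_image \<iota> B \<mu> \<beta> gens = L_op \<iota> B \<mu> \<beta> gens ` cochains B 2"

text \<open>
  The cokernel is the set of cosets of the image.  Its addition is the sum of sets, its zero is
  the coset of \<open>0\<close>.  Adding the image in the scalar multiplication only matters for the scalar \<open>0\<close>.
\<close>

definition coker ::
  "('f::field \<Rightarrow> 'k::field) \<Rightarrow> ('g::{group_add,finite}, 'k, 'v::ab_group_add) gspace \<Rightarrow>
   ('v \<Rightarrow> 'v \<Rightarrow> 'v) \<Rightarrow> (('g, 'f) free_alg \<Rightarrow> 'g word \<Rightarrow> (nat \<times> 'g) bracketed) \<Rightarrow>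
   ('g, 'f) generator list \<Rightarrow> 'v target set set" where
  "coker \<iota> B \<mu> \<beta> gens = (\<lambda>q. q +o L_image \<iota> B \<mu> \<beta> gens) ` target_space B gens"

definition coker_zero ::
  "('f::field \<Rightarrow> 'k::field) \<Rightarrow> ('g::{group_add,finite}, 'k, 'v::ab_group_add) gspace \<Rightarrow>
   ('v \<Rightarrow> 'v \<Rightarrow> 'v) \<Rightarrow> (('g, 'f) free_alg \<Rightarrow> 'g word \<Rightarrow> (nat \<times> 'g) bracketed) \<Rightarrow>
   ('g, 'f) generator list \<Rightarrow> 'v target set" where
  "coker_zero \<iota> B \<mu> \<beta> gens = 0 +o L_image \<iota> B \<mu> \<beta> gens"

definition coker_scale ::
  "('f::field \<Rightarrow> 'k::field) \<Rightarrow> ('g::{group_add,finite}, 'k, 'v::ab_group_add) gspace \<Rightarrow>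
   ('v \<Rightarrow> 'v \<Rightarrow> 'v) \<Rightarrow> (('g, 'f) free_alg \<Rightarrow> 'g word \<Rightarrow> (nat \<times> 'g) bracketed) \<Rightarrow>
   ('g, 'f) generator list \<Rightarrow> 'k \<Rightarrow> 'v target set \<Rightarrow> 'v target set" where
  "coker_scale \<iota> B \<mu> \<beta> gens c X = target_scale B c ` X + L_image \<iota> B \<mu> \<beta> gens"

definition coker_isomorphic ::
  "('f::field \<Rightarrow> 'k::field) \<Rightarrow> ('g::{group_add,finite}, 'k, 'v::ab_group_add) gspace \<Rightarrow>
   ('v \<Rightarrow> 'v \<Rightarrow> 'v) \<Rightarrow> (('g, 'f) free_alg \<Rightarrow> 'g word \<Rightarrow> (nat \<times> 'g) bracketed) \<Rightarrow>
   ('g, 'f) generator list \<Rightarrow> ('g, 'f) generator list \<Rightarrow> bool" where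
  "coker_isomorphic \<iota> B \<mu> \<beta> gens gens' \<longleftrightarrow>
     (\<exists>\<Phi>. bij_betw \<Phi> (coker \<iota> B \<mu> \<beta> gens) (coker \<iota> B \<mu> \<beta> gens') \<and>
        (\<forall>X\<in>coker \<iota> B \<mu> \<beta> gens. \<forall>Y\<in>coker \<iota> B \<mu> \<beta> gens. \<Phi> (X + Y) = \<Phi> X + \<Phi> Y) \<and>
        (\<forall>c. \<forall>X\<in>coker \<iota> B \<mu> \<beta> gens.
           \<Phi> (coker_scale \<iota> B \<mu> \<beta> gens c X) = coker_scale \<iota> B \<mu> \<beta> gens' c (\<Phi> X)))"

definition obstruction ::
  "('f::field \<Rightarrow> 'k::field) \<Rightarrow> ('g::{group_add,finite}, 'k, 'v::ab_group_add) gspace \<Rightarrow>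
   ('v \<Rightarrow> 'v \<Rightarrow> 'v) \<Rightarrow> (('g, 'f) free_alg \<Rightarrow> 'g word \<Rightarrow> (nat \<times> 'g) bracketed) \<Rightarrow>
   ('g, 'f) generator list \<Rightarrow> ('v list \<Rightarrow> 'v) \<Rightarrow> 'v target set" where
  "obstruction \<iota> B \<mu> \<beta> gens \<phi> =
     (Q_ass \<phi>, \<lambda>j. if j < length gens then Q_gen \<iota> B \<mu> \<beta> (gens ! j) \<phi> else 0)
       +o L_image \<iota> B \<mu> \<beta> gens"

end

theory Submission
  imports Defs
begin

text \<open>
  Every condition on a lift can be read off coefficient by coefficient.  For \<open>M = \<mu> + t \<phi> + t\<^sup>2 \<psi>\<close> the
  coefficients of \<open>1\<close> and \<open>t\<close> in the associator and in a generator \<open>f\<^sub>j\<close> vanish, because \<open>\<mu>\<close> is an associative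
  law satisfying \<open>I\<close> and \<open>\<phi>\<close> is a cocycle.  Since \<open>\<psi>\<close> carries the factor \<open>t\<^sup>2\<close>, it enters the coefficient of
  \<open>t\<^sup>2\<close> linearly, through the first differentials: this coefficient is \<open>\<partial>\<psi> + Q(\<phi>)\<close> for the associator
  (\<open>second_order_mult_iff\<close>) and \<open>D f\<^sub>j(\<psi>) + Q\<^sub>j(\<phi>)\<close> for the generator (\<open>tlaw_eval_coeffs\<close>).  So \<open>M\<close> is a lift
  exactly when \<open>\<psi>\<close> solves the two equations, provided that it is enough to test the \<open>f\<^sub>j\<close>, and to test them at
  arguments in \<open>B\<close>.  The first holds because the identities of a graded algebra form a graded \<open>T\<close>-ideal
  (\<open>graded_T_ideal_identities\<close>), the second because the \<open>f\<^sub>j\<close> are multilinear, so that evaluation is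
  multilinear over \<open>k[t]\<close> (\<open>identity_on_constants\<close>).
  
  The equations say that the negative of the obstruction cochain lies in the image of the linear
  operator, that is, that the class vanishes.  Liftability mentions neither the generators nor the
  bracketings, and the space \<open>Z\<^sup>2\<close> does not depend on the bracketings either, since \<open>\<mu> + t \<phi>\<close> is
  associative modulo \<open>t\<^sup>2\<close>; hence the vanishing of the class is independent of both.  An isomorphism of
  first-order deformations has the form \<open>1 + t \<theta>\<close>, and the same formula over \<open>k[t]/(t\<^sup>3)\<close> transports lifts
  (\<open>transport_lift\<close>).
  
  The cokernel itself does change with the generators.  Adjoining the zero polynomial in no variables
  enlarges the target by a copy of \<open>B\<close> and leaves the image unchanged, and finite-dimensional spaces
  of different dimensions are not isomorphic (\<open>coker_depends_on_generators\<close>).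
\<close>

section \<open>Quotients of finite-dimensional spaces\<close>

text \<open>
  Passing to the kernel of one functional costs at most one spanning vector, and the common kernel
  of all of them is zero.
\<close>

lemma (in vector_space) finite_span_if_separated:
  assumes "finite \<Lambda>" and "subspace T"
    and "\<And>l x y. l \<in> \<Lambda> \<Longrightarrow> l (x + y) = l x + l y"
    and "\<And>l c x. l \<in> \<Lambda> \<Longrightarrow> l (scale c x) = c * l x"
    and "\<And>x. x \<in> T \<Longrightarrow> (\<And>l. l \<in> \<Lambda> \<Longrightarrow> l x = (0::'a)) \<Longrightarrow> x = 0"
  shows "\<exists>S. finite S \<and> T \<subseteq> span S"
  using assms
proof (induction \<Lambda> arbitrary: T rule: finite_induct)
  case empty
  then have "T \<subseteq> span {}" by auto
  then show ?case by blast
next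
  case (insert l \<Lambda>)
  define T0 where "T0 = {x \<in> T. l x = 0}"
  have add: "l (x + y) = l x + l y" and scl: "l (scale c x) = c * l x" for x y c
    using insert.prems(2,3) by auto
  have "l 0 = 0" using scl[of 0 0] by simp
  then have "subspace T0"
    using \<open>subspace T\<close> add scl by (auto simp: subspace_def T0_def)
  moreover have "x = 0" if "x \<in> T0" "\<And>m. m \<in> \<Lambda> \<Longrightarrow> m x = 0" for x
    using insert.prems(4)[of x] that by (auto simp: T0_def)
  ultimately have "\<exists>S. finite S \<and> T0 \<subseteq> span S"
    using insert.prems(2,3) by (intro insert.IH) auto
  then obtain S where S: "finite S" "T0 \<subseteq> span S" by blast
  show ?case
  proof (cases "T0 = T")
    case True
    then show ?thesis using S by blast
  next
    case False
    then obtain t where t: "t \<in> T" "l t \<noteq> 0" by (auto simp: T0_def)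
    have "x \<in> span (insert t S)" if "x \<in> T" for x
    proof -
      define y where "y = x - scale (l x / l t) t"
      have "l x = l y + l x" using add[of y "scale (l x / l t) t"] t scl by (simp add: y_def)
      then have "l y = 0" by simp
      moreover have "y \<in> T"
        unfolding y_def using t that \<open>subspace T\<close> by (intro subspace_diff subspace_scale)
      ultimately have "y \<in> span (insert t S)"
        using S(2) span_mono[of S "insert t S"] by (auto simp: T0_def)
      moreover have "scale (l x / l t) t \<in> span (insert t S)"
        by (intro span_scale span_base) simp
      ultimately have "y + scale (l x / l t) t \<in> span (insert t S)" by (rule span_add)
      then show ?thesis by (simp add: y_def)
    qed
    then show ?thesis using S(1) by (intro exI[of _ "insert t S"]) auto
  qed
qed

lemma (in vector_space) coset_eq_iff:
  assumes "subspace L"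
  shows "q +o L = q' +o L \<longleftrightarrow> q - q' \<in> L"
proof
  assume "q +o L = q' +o L"
  moreover have "q \<in> q +o L" using subspace_0[OF assms] set_plus_intro2[of 0 L q] by simp
  ultimately show "q - q' \<in> L" using set_minus_plus by blast
next
  assume d: "q - q' \<in> L"
  have "x - q \<in> L \<longleftrightarrow> x - q' \<in> L" for x
  proof
    assume "x - q \<in> L"
    then have "(x - q) + (q - q') \<in> L" using d assms by (rule subspace_add[rotated])
    then show "x - q' \<in> L" by simp
  next
    assume "x - q' \<in> L"
    then have "(x - q') - (q - q') \<in> L" using d assms by (rule subspace_diff[rotated])
    then show "x - q \<in> L" by simp
  qed
  then show "q +o L = q' +o L" by (auto simp: set_minus_plus[symmetric])
qed

lemma (in vector_space) subspace_set_plus: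
  assumes "subspace L"
  shows "L + L = L"
proof
  show "L + L \<subseteq> L" using assms by (auto simp: set_plus_def subspace_add)
  show "L \<subseteq> L + L" using subspace_0[OF assms] by (rule set_zero_plus2)
qed

lemma (in vector_space) coset_plus:
  assumes "subspace L"
  shows "(q +o L) + (q' +o L) = (q + q') +o L"
  by (simp add: set_plus_rearrange subspace_set_plus[OF assms])

lemma (in vector_space) coset_scale:
  assumes L: "subspace L"
  shows "scale c ` (q +o L) + L = scale c q +o L"
proof -
  have "scale c ` (q +o L) + L \<subseteq> scale c q +o L"
  proof
    fix x assume "x \<in> scale c ` (q +o L) + L"
    then obtain l l' where "l \<in> L" "l' \<in> L" "x = scale c (q + l) + l'"
      by (auto simp: set_plus_def elt_set_plus_def)
    then have "x - scale c q = scale c l + l'" "scale c l + l' \<in> L"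
      using L by (auto simp: scale_right_distrib subspace_add subspace_scale)
    then show "x \<in> scale c q +o L" by (simp add: set_minus_plus[symmetric])
  qed
  moreover have "scale c q +o L \<subseteq> scale c ` (q +o L) + L"
    using subspace_0[OF L] by (intro set_plus_mono3 imageI) (auto simp: elt_set_plus_def)
  ultimately show ?thesis by blast
qed

text \<open>
  The proof compares \<open>dim T\<close> and \<open>dim T'\<close>.  A basis of \<open>L\<close>, together with one representative of the
  image of each further vector of a basis of \<open>T\<close>, spans \<open>T'\<close>; so \<open>T'\<close> is spanned by at most \<open>dim T\<close>
  vectors and cannot be strictly larger than \<open>T\<close>.  The maps are stated on sets of cosets, because the
  quotients are not types.
\<close>

lemma (in vector_space) no_linear_surjection_onto_larger_quotient:
  assumes L: "subspace L" and T: "subspace T" and T': "subspace T'"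
    and LT: "L \<subseteq> T" and TT': "T \<subset> T'"
    and fin: "finite S" "T \<subseteq> span S"
    and surj: "\<Phi> ` ((\<lambda>q. q +o L) ` T) = (\<lambda>q. q +o L) ` T'"
    and add: "\<And>X Y. X \<in> (\<lambda>q. q +o L) ` T \<Longrightarrow> Y \<in> (\<lambda>q. q +o L) ` T \<Longrightarrow> \<Phi> (X + Y) = \<Phi> X + \<Phi> Y"
    and scl: "\<And>c X. X \<in> (\<lambda>q. q +o L) ` T \<Longrightarrow> \<Phi> (scale c ` X + L) = scale c ` \<Phi> X + L"
  shows False
proof -
  define rep where "rep q = (SOME y. y \<in> T' \<and> \<Phi> (q +o L) = y +o L)" for q
  have rep: "\<Phi> (q +o L) = rep q +o L" if "q \<in> T" for q
  proof -
    have "\<exists>y. y \<in> T' \<and> \<Phi> (q +o L) = y +o L" using surj that by blast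
    then show ?thesis unfolding rep_def by (rule someI2_ex) simp
  qed
  have rep_add: "rep (x + y) - (rep x + rep y) \<in> L" if "x \<in> T" "y \<in> T" for x y
  proof -
    have "rep (x + y) +o L = \<Phi> ((x +o L) + (y +o L))"
      using that rep[of "x + y"] T by (simp add: coset_plus[OF L] subspace_add)
    also have "\<dots> = (rep x +o L) + (rep y +o L)"
      using add that by (simp add: rep)
    also have "\<dots> = (rep x + rep y) +o L" by (rule coset_plus[OF L])
    finally show ?thesis by (simp add: coset_eq_iff[OF L])
  qed
  have rep_scale: "rep (scale c x) - scale c (rep x) \<in> L" if "x \<in> T" for c x
  proof -
    have "rep (scale c x) +o L = \<Phi> (scale c ` (x +o L) + L)"
      using that rep[of "scale c x"] T by (simp add: coset_scale[OF L] subspace_scale)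
    also have "\<dots> = scale c ` (rep x +o L) + L" using scl that by (simp add: rep)
    also have "\<dots> = scale c (rep x) +o L" by (rule coset_scale[OF L])
    finally show ?thesis by (simp add: coset_eq_iff[OF L])
  qed
  obtain C where C: "C \<subseteq> L" "independent C" "L \<subseteq> span C"
    using maximal_independent_subset by blast
  obtain D where D: "C \<subseteq> D" "D \<subseteq> T" "independent D" "T \<subseteq> span D"
    using maximal_independent_subset_extend[of C T] C LT by blast
  have finD: "finite D" using independent_span_bound[OF fin(1) D(3)] D(2) fin(2) by blast
  define R where "R = C \<union> rep ` (D - C)"
  have finR: "finite R" using finD D(1) finite_subset by (auto simp: R_def)
  have "card R \<le> card C + card (rep ` (D - C))" unfolding R_def by (rule card_Un_le)
  also have "\<dots> \<le> card C + card (D - C)" using finD by (simp add: card_image_le)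
  also have "\<dots> = card D"
    using D(1) finD by (metis card_Diff_subset card_mono finite_subset le_add_diff_inverse)
  finally have cardR: "card R \<le> card D" .
  have LR: "L \<subseteq> span R" using C(3) span_mono[of C R] by (auto simp: R_def)
  have mod_L: "x \<in> span R" if "x - y \<in> L" "y \<in> span R" for x y
    using span_add[of "x - y" R y] that LR by auto
  \<comment> \<open>\<open>rep\<close> is linear modulo \<open>L\<close>, so it is enough to control it on the basis \<open>D\<close>.\<close>
  define P where "P = {x \<in> T. rep x \<in> span R}"
  have "subspace P"
  proof (rule subspaceI)
    have "rep (scale 0 0) - scale 0 (rep 0) \<in> L" using rep_scale[of 0 0] T subspace_0 by blast
    then show "0 \<in> P" using LR T by (auto simp: P_def subspace_0)
    show "x + y \<in> P" if "x \<in> P" "y \<in> P" for x y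
      using that T by (auto simp: P_def subspace_add intro: mod_L[OF rep_add] span_add)
    show "scale c x \<in> P" if "x \<in> P" for c x
      using that T by (auto simp: P_def subspace_scale intro: mod_L[OF rep_scale] span_scale)
  qed
  moreover have "D \<subseteq> P"
  proof
    fix b assume b: "b \<in> D"
    show "b \<in> P"
    proof (cases "b \<in> C")
      case True
      have "b \<in> T" "0 \<in> T" using b D(2) T subspace_0 by auto
      have "b +o L = 0 +o L" using True C(1) by (subst coset_eq_iff[OF L]) auto
      then have "rep b = rep 0" by (simp add: rep_def)
      then show ?thesis using \<open>subspace P\<close> \<open>b \<in> T\<close> by (auto simp: P_def dest: subspace_0)
    next
      case False
      then show ?thesis using b D(2) by (auto simp: P_def R_def intro: span_base)
    qed
  qed
  ultimately have TP: "T \<subseteq> P" using D(4) span_minimal by blast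
  have T'R: "T' \<subseteq> span R"
  proof
    fix y assume "y \<in> T'"
    then have "y +o L \<in> \<Phi> ` ((\<lambda>q. q +o L) ` T)" using surj by blast
    then obtain x where x: "x \<in> T" "y +o L = \<Phi> (x +o L)" by blast
    then have "y - rep x \<in> L" by (simp add: rep coset_eq_iff[OF L])
    then show "y \<in> span R" using x TP by (auto simp: P_def intro: mod_L)
  qed
  obtain z where z: "z \<in> T'" "z \<notin> T" using TT' by blast
  then have zD: "z \<notin> span D" using span_minimal[OF D(2) T] by blast
  then have "independent (insert z D)" using D(3) by (rule independent_insertI)
  moreover have "insert z D \<subseteq> span R" using z D(2) TT' T'R by blast
  ultimately have "card (insert z D) \<le> card R" using independent_span_bound[OF finR] by blast
  moreover have "z \<notin> D" using zD span_base by blast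
  ultimately show False using cardR finD by simp
qed

section \<open>Identities of a graded algebra\<close>

lemma poly_mapping_sum_induct [case_names zero single add]:
  fixes f :: "'a \<Rightarrow>\<^sub>0 'b::monoid_add"
  assumes "P 0" and single: "\<And>w c. P (Poly_Mapping.single w c)"
    and "\<And>f h. P f \<Longrightarrow> P h \<Longrightarrow> P (f + h)"
  shows "P f"
proof (induction f rule: update_induct)
  case const
  then show ?case by (rule assms(1))
next
  case (update f w c)
  have "Poly_Mapping.update w c f = Poly_Mapping.single w c + f"
    using update(1)
    by (intro poly_mapping_eqI) (auto simp: lookup_update lookup_add lookup_single in_keys_iff)
  then show ?case using update assms by metis
qed

text \<open>
  The operation is bilinear on the whole type, but associative and unital only on the carrier \<open>S\<close>.
  This is the situation of truncated polynomials: the product is cut at order \<open>n\<close>, so multiplying by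
  the unit truncates sequences that do not belong to \<open>B \<otimes> k[t]/(t\<^sup>n)\<close>.
\<close>

locale unital_graded_algebra = vector_space s
  for s :: "'f::field \<Rightarrow> 'w::ab_group_add \<Rightarrow> 'w" +
  fixes S :: "'w set" and W :: "'g::group_add \<Rightarrow> 'w set" and u :: 'w and M :: "'w \<Rightarrow> 'w \<Rightarrow> 'w"
  assumes mult: "unital_graded_mult S W u M"
    and subspace_W: "subspace (W g)"
    and W_sub: "W g \<subseteq> S"
    and M_add: "M (x + y) z = M x z + M y z" "M z (x + y) = M z x + M z y"
    and M_scale: "M (s c x) y = s c (M x y)" "M x (s c y) = s c (M x y)"
begin

lemma M_zero: "M 0 x = 0" "M x 0 = 0"
  using M_add(1)[of 0 0 x] M_add(2)[of x 0 0] by simp_all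

lemma assignment_in: "graded_assignment W a \<Longrightarrow> a x \<in> S"
  using W_sub by (cases x) (auto simp: graded_assignment_def)

lemma foldr_in:
  assumes "\<And>x. a x \<in> S"
  shows "foldr M (map a w) u \<in> S"
  using assms mult by (induction w) (auto simp: unital_graded_mult_def)

lemma foldr_append_word:
  assumes "\<And>x. a x \<in> S"
  shows "foldr M (map a (v @ w)) u = M (foldr M (map a v) u) (foldr M (map a w) u)"
proof (induction v)
  case Nil
  then show ?case using foldr_in[of a w, OF assms] mult by (simp add: unital_graded_mult_def)
next
  case (Cons x v)
  then show ?case
    using foldr_in[of a, OF assms] mult assms by (simp add: unital_graded_mult_def)
qed

lemma foldr_graded:
  assumes "graded_assignment W a"
  shows "foldr M (map a w) u \<in> W (sum_list (map snd w))"
  using assms mult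
  by (induction w) (auto simp: unital_graded_mult_def graded_assignment_def)

abbreviation ev :: "('g, 'f) free_alg \<Rightarrow> (nat \<times> 'g \<Rightarrow> 'w) \<Rightarrow> 'w" where
  "ev \<equiv> assoc_eval s u M"

lemma ev_superset:
  assumes "finite A" "Poly_Mapping.keys f \<subseteq> A"
  shows "ev f a = (\<Sum>w\<in>A. s (Poly_Mapping.lookup f w) (foldr M (map a w) u))"
  unfolding assoc_eval_def
  by (rule sum.mono_neutral_left) (use assms in \<open>auto simp: in_keys_iff\<close>)

lemma ev_zero: "ev 0 a = 0"
  by (simp add: assoc_eval_def)

lemma ev_add: "ev (f + h) a = ev f a + ev h a"
proof -
  let ?A = "Poly_Mapping.keys f \<union> Poly_Mapping.keys h"
  have "Poly_Mapping.keys (f + h) \<subseteq> ?A" by (rule keys_add)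
  then show ?thesis
    by (simp add: ev_superset[of ?A] lookup_add scale_left_distrib sum.distrib)
qed

lemma ev_single: "ev (Poly_Mapping.single w c) a = s c (foldr M (map a w) u)"
  by (subst ev_superset[of "{w}"]) auto

lemma ev_mult:
  assumes a: "\<And>x. a x \<in> S"
  shows "ev (f * h) a = M (ev f a) (ev h a)"
proof (induction f rule: poly_mapping_sum_induct)
  case zero
  then show ?case by (simp add: ev_zero M_zero)
next
  case (single w c)
  show ?case
  proof (induction h rule: poly_mapping_sum_induct)
    case zero
    then show ?case by (simp add: ev_zero M_zero)
  next
    case (single v d)
    then show ?case
      by (simp add: mult_single ev_single M_scale plus_list_def foldr_append_word[OF a] mult.commute
          del: map_append foldr_append)
  next
    case (add f h)
    then show ?case by (simp add: distrib_left ev_add M_add)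
  qed
next
  case (add f h)
  then show ?case by (simp add: distrib_right ev_add M_add)
qed

lemma ev_const: "ev (Poly_Mapping.single 0 c * f) a = s c (ev f a)"
proof (induction f rule: poly_mapping_sum_induct)
  case (single w d)
  then show ?case by (simp add: mult_single ev_single zero_list_def plus_list_def)
qed (simp_all add: ev_zero ev_add distrib_left scale_right_distrib)

lemma ev_homogeneous:
  assumes "f \<in> homogeneous g" "graded_assignment W a"
  shows "ev f a \<in> W g"
  unfolding assoc_eval_def
proof (intro subspace_sum subspace_W subspace_scale)
  fix w assume "w \<in> Poly_Mapping.keys f"
  then show "foldr M (map a w) u \<in> W g"
    using foldr_graded[OF assms(2), of w] assms(1) by (simp add: homogeneous_def)
qed

text \<open>
  Evaluation and a graded endomorphism are both multiplicative, so their composite is again an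
  evaluation, at the values of the images of the variables.  The new assignment is graded because
  the endomorphism preserves degrees.
\<close>

lemma ev_graded_endo:
  assumes \<Phi>: "graded_endo \<Phi>" and a: "graded_assignment W a"
  defines "b \<equiv> \<lambda>x. ev (\<Phi> (Poly_Mapping.single [x] 1)) a"
  shows "graded_assignment W b" and "ev (\<Phi> f) a = ev f b"
proof -
  have "b (i, g) \<in> W g" for i g
  proof -
    have "Poly_Mapping.single [(i, g)] 1 \<in> homogeneous g" by (simp add: homogeneous_def)
    then have "\<Phi> (Poly_Mapping.single [(i, g)] 1) \<in> homogeneous g"
      using \<Phi> unfolding graded_endo_def by blast
    then show ?thesis using a by (simp add: b_def ev_homogeneous)
  qed
  then show b: "graded_assignment W b" by (simp add: graded_assignment_def)
  have aS: "\<And>x. a x \<in> S" using a by (rule assignment_in)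
  have one: "\<Phi> 1 = 1" and add: "\<Phi> (p + q) = \<Phi> p + \<Phi> q"
    and mult: "\<Phi> (p * q) = \<Phi> p * \<Phi> q"
    and const: "\<Phi> (Poly_Mapping.single 0 c * p) = Poly_Mapping.single 0 c * \<Phi> p" for p q c
    using \<Phi> by (auto simp: graded_endo_def)
  have word: "ev (\<Phi> (Poly_Mapping.single w 1)) a = foldr M (map b w) u" for w
  proof (induction w)
    case Nil
    have "Poly_Mapping.single [] 1 = (1 :: ('g, 'f) free_alg)"
      by (metis single_one zero_list_def)
    then show ?case using ev_single[of "[]" 1 a] by (simp add: one)
  next
    case (Cons x w)
    have "Poly_Mapping.single (x # w) 1 = Poly_Mapping.single [x] 1 * Poly_Mapping.single w (1::'f)"
      by (simp add: mult_single plus_list_def)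
    then show ?case using Cons by (simp add: mult ev_mult[OF aS] b_def)
  qed
  show "ev (\<Phi> f) a = ev f b"
  proof (induction f rule: poly_mapping_sum_induct)
    case zero
    show ?case using add[of 0 0] by (simp add: ev_zero)
  next
    case (single w c)
    have "ev (\<Phi> (Poly_Mapping.single 0 c * Poly_Mapping.single w 1)) a = s c (foldr M (map b w) u)"
      unfolding const ev_const word ..
    then show ?case by (simp add: mult_single zero_list_def plus_list_def ev_single)
  next
    case (add f h)
    then show ?case using \<Phi> by (simp add: graded_endo_def ev_add)
  qed
qed

lemma graded_T_ideal_identities:
  "graded_T_ideal {f. \<forall>a. graded_assignment W a \<longrightarrow> ev f a = 0}"
  (is "graded_T_ideal ?J")
proof -
  have "\<Phi> f \<in> ?J" if "graded_endo \<Phi>" "f \<in> ?J" for \<Phi> f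
  proof (intro CollectI allI impI)
    fix a assume a: "graded_assignment W a"
    show "ev (\<Phi> f) a = 0"
      unfolding ev_graded_endo(2)[OF that(1) a, of f]
      using that(2) ev_graded_endo(1)[OF that(1) a] by blast
  qed
  moreover have "0 \<in> ?J" "\<forall>p\<in>?J. \<forall>q\<in>?J. p + q \<in> ?J" "\<forall>p\<in>?J. \<forall>q. q * p \<in> ?J \<and> p * q \<in> ?J"
    by (auto simp: ev_zero ev_add M_zero ev_mult assignment_in)
  ultimately show ?thesis unfolding graded_T_ideal_def by blast
qed

text \<open>
  The identities of an algebra form a graded \<open>T\<close>-ideal, so those of a \<open>T\<close>-ideal need only be tested
  on its generators.
\<close>

lemma satisfies_hull_iff:
  "satisfies s W u M (graded_T_ideal hull F) \<longleftrightarrow> satisfies s W u M F"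
proof
  assume "satisfies s W u M F"
  then have "F \<subseteq> {f. \<forall>a. graded_assignment W a \<longrightarrow> ev f a = 0}"
    by (auto simp: satisfies_def)
  then have "graded_T_ideal hull F \<subseteq> {f. \<forall>a. graded_assignment W a \<longrightarrow> ev f a = 0}"
    using graded_T_ideal_identities by (rule hull_minimal)
  then show "satisfies s W u M (graded_T_ideal hull F)" by (auto simp: satisfies_def)
qed (auto simp: satisfies_def hull_inc)

text \<open>
  By associativity every bracketing of a word has the value of the bracketing to the right.
\<close>

lemma law_eval_eq_assoc_eval:
  assumes "bracketing \<beta>" "\<And>x. a x \<in> S"
  shows "law_eval s u M \<beta> f a = assoc_eval s u M f a"
proof -
  have *: "bracketed_eval M a t = foldr M (map a (leaves t)) u" for t
  proof (induction t)
    case (Var x)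
    show ?case using assms(2) mult by (simp add: unital_graded_mult_def)
  next
    case (Mul l r)
    then show ?case
      using foldr_append_word[where a = a and v = "leaves l" and w = "leaves r", OF assms(2)]
      by simp
  qed
  then show ?thesis
    unfolding law_eval_def assoc_eval_def using assms(1)
    by (intro sum.cong) (auto simp: bracketing_def)
qed

end

section \<open>Multilinearity of bracketed evaluation\<close>

lemma bracketed_eval_cong:
  "(\<And>x. x \<in> set (leaves t) \<Longrightarrow> a x = b x) \<Longrightarrow> bracketed_eval M a t = bracketed_eval M b t"
  by (induction t) auto

lemma bracketed_eval_fun_upd_other:
  "x \<notin> set (leaves t) \<Longrightarrow> bracketed_eval M (a(x := y)) t = bracketed_eval M a t"
  by (rule bracketed_eval_cong) auto

lemma bracketed_eval_add:
  assumes "\<And>x y z. M (x + y) z = M x z + M y z" "\<And>x y z. M z (x + y) = M z x + M z y"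
    and "distinct (leaves t)" "x \<in> set (leaves t)"
  shows "bracketed_eval M (a(x := y + z)) t
    = bracketed_eval M (a(x := y)) t + bracketed_eval M (a(x := z)) t"
  using assms(3,4)
proof (induction t)
  case (Mul l r)
  then show ?case
    by (cases "x \<in> set (leaves l)") (auto simp: bracketed_eval_fun_upd_other disjoint_iff assms(1,2)
          simp del: fun_upd_apply)
qed simp

text \<open>
  The operator \<open>\<sigma>\<close> plays the role of a scalar.  It will be a scalar of the field in one application and
  multiplication by \<open>t\<close> in the other.
\<close>

lemma bracketed_eval_operator:
  assumes "\<And>x y. M (\<sigma> x) y = \<sigma> (M x y)" "\<And>x y. M x (\<sigma> y) = \<sigma> (M x y)"
    and "distinct (leaves t)" "x \<in> set (leaves t)"
  shows "bracketed_eval M (a(x := \<sigma> y)) t = \<sigma> (bracketed_eval M (a(x := y)) t)"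
  using assms(3,4)
proof (induction t)
  case (Mul l r)
  then show ?case
    by (cases "x \<in> set (leaves l)") (auto simp: bracketed_eval_fun_upd_other disjoint_iff assms(1,2)
          simp del: fun_upd_apply)
qed simp

text \<open>
  Every word of a multilinear polynomial is a permutation of its variables, so its bracketing
  contains each of them exactly once.
\<close>

lemma multilinear_generator_word:
  assumes "multilinear_generator F" "w \<in> Poly_Mapping.keys (snd F)" "bracketing \<beta>"
  shows "set w = set (fst F)" and "w \<noteq> [] \<Longrightarrow> distinct (leaves (\<beta> f w))"
    and "w \<noteq> [] \<Longrightarrow> set (leaves (\<beta> f w)) = set (fst F)"
proof -
  have m: "mset w = mset (fst F)" "distinct (fst F)"
    using assms by (auto simp: multilinear_generator_def)
  show *: "set w = set (fst F)" using mset_eq_setD[OF m(1)] .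
  have d: "distinct w" using mset_eq_imp_distinct_iff[OF m(1)] m(2) by simp
  assume "w \<noteq> []"
  then have "leaves (\<beta> f w) = w" using assms(3) by (simp add: bracketing_def)
  with * d show "distinct (leaves (\<beta> f w))" "set (leaves (\<beta> f w)) = set (fst F)" by simp_all
qed

lemma law_eval_cong:
  assumes "multilinear_generator F" "bracketing \<beta>" "\<And>x. x \<in> set (fst F) \<Longrightarrow> a x = b x"
  shows "law_eval s u M \<beta> (snd F) a = law_eval s u M \<beta> (snd F) b"
proof -
  have "(if w = [] then u else bracketed_eval M a (\<beta> (snd F) w))
      = (if w = [] then u else bracketed_eval M b (\<beta> (snd F) w))"
    if "w \<in> Poly_Mapping.keys (snd F)" for w
    using multilinear_generator_word(3)[OF assms(1) that assms(2), of "snd F"] assms(3)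
    by (auto intro!: bracketed_eval_cong)
  then show ?thesis unfolding law_eval_def by (intro sum.cong) simp_all
qed

lemma law_eval_add:
  assumes "multilinear_generator F" "bracketing \<beta>" "x \<in> set (fst F)"
    and "\<And>x y z. M (x + y) z = M x z + M y z" "\<And>x y z. M z (x + y) = M z x + M z y"
    and "\<And>c x y. s c (x + y) = s c x + s c y"
  shows "law_eval s u M \<beta> (snd F) (a(x := y + z))
    = law_eval s u M \<beta> (snd F) (a(x := y)) + law_eval s u M \<beta> (snd F) (a(x := z))"
proof -
  have "s c (if w = [] then u else bracketed_eval M (a(x := y + z)) (\<beta> (snd F) w))
      = s c (if w = [] then u else bracketed_eval M (a(x := y)) (\<beta> (snd F) w))
      + s c (if w = [] then u else bracketed_eval M (a(x := z)) (\<beta> (snd F) w))"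
    if "w \<in> Poly_Mapping.keys (snd F)" for w c
    using multilinear_generator_word[OF assms(1) that assms(2)] assms(3)
    by (cases "w = []") (auto simp: bracketed_eval_add[of M, OF assms(4,5)] assms(6)
        simp del: fun_upd_apply)
  then show ?thesis unfolding law_eval_def sum.distrib[symmetric] by (intro sum.cong) simp_all
qed

lemma law_eval_operator:
  assumes "multilinear_generator F" "bracketing \<beta>" "x \<in> set (fst F)"
    and "\<And>x y. M (\<sigma> x) y = \<sigma> (M x y)" "\<And>x y. M x (\<sigma> y) = \<sigma> (M x y)"
    and "\<And>c x. s c (\<sigma> x) = \<sigma> (s c x)" "\<sigma> 0 = 0" "\<And>x y. \<sigma> (x + y) = \<sigma> x + \<sigma> y"
  shows "law_eval s u M \<beta> (snd F) (a(x := \<sigma> y)) = \<sigma> (law_eval s u M \<beta> (snd F) (a(x := y)))"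
proof -
  have sum: "\<sigma> (sum f A) = (\<Sum>i\<in>A. \<sigma> (f i))" for f :: "'d \<Rightarrow> 'c" and A
    by (induction A rule: infinite_finite_induct) (simp_all add: assms(7,8))
  have "s c (if w = [] then u else bracketed_eval M (a(x := \<sigma> y)) (\<beta> (snd F) w))
      = \<sigma> (s c (if w = [] then u else bracketed_eval M (a(x := y)) (\<beta> (snd F) w)))"
    if "w \<in> Poly_Mapping.keys (snd F)" for w c
    using multilinear_generator_word[OF assms(1) that assms(2)] assms(3)
    by (cases "w = []") (auto simp: bracketed_eval_operator[of M \<sigma>, OF assms(4,5)] assms(6)
        simp del: fun_upd_apply)
  then show ?thesis unfolding law_eval_def sum by (intro sum.cong) simp_all
qed

section \<open>Graded spaces and cochains of low degree\<close>

definition bilinear_law :: "('g, 'k, 'v::ab_group_add) gspace \<Rightarrow> ('v \<Rightarrow> 'v \<Rightarrow> 'v) \<Rightarrow> bool" where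
  "bilinear_law B m \<longleftrightarrow>
     (\<forall>x y z. m (x + y) z = m x z + m y z \<and> m z (x + y) = m z x + m z y) \<and>
     (\<forall>c x y. m (gscale B c x) y = gscale B c (m x y) \<and> m x (gscale B c y) = gscale B c (m x y))"

lemma bilinear_law_simps:
  assumes "bilinear_law B m"
  shows "m (x + y) z = m x z + m y z" "m z (x + y) = m z x + m z y"
    and "m (gscale B c x) y = gscale B c (m x y)" "m x (gscale B c y) = gscale B c (m x y)"
    and "m 0 x = 0" "m x 0 = 0" "m (- x) y = - m x y" "m x (- y) = - m x y"
    and "m (x - y) z = m x z - m y z" "m z (x - y) = m z x - m z y"
proof -
  show add: "m (x + y) z = m x z + m y z" "m z (x + y) = m z x + m z y" for x y z
    using assms by (auto simp: bilinear_law_def)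
  show "m (gscale B c x) y = gscale B c (m x y)" "m x (gscale B c y) = gscale B c (m x y)"
    using assms by (auto simp: bilinear_law_def)
  show zero: "m 0 x = 0" "m x 0 = 0" for x
    using add(1)[of 0 0 x] add(2)[of x 0 0] by simp_all
  show "m (- x) y = - m x y" "m x (- y) = - m x y" for x y
    using add(1)[of "- x" x y] add(2)[of x "- y" y] zero
    by (simp_all add: eq_neg_iff_add_eq_0)
  show "m (x - y) z = m x z - m y z" "m z (x - y) = m z x - m z y"
    using add(1)[of "x - y" y z] add(2)[of z "x - y" y] by simp_all
qed

locale graded_algebra_over =
  fixes \<iota> :: "'f::field \<Rightarrow> 'k::field"
    and B :: "('g::{group_add,finite}, 'k, 'v::ab_group_add) gspace"
    and \<mu> :: "'v \<Rightarrow> 'v \<Rightarrow> 'v"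
  assumes embedding: "field_embedding \<iota>"
    and algebra: "graded_algebra B \<mu>"
begin

sublocale vector_space "gscale B"
  using algebra by (simp add: graded_algebra_def graded_space_def)

lemma linear_iff_additive:
  "Vector_Spaces.linear (gscale B) (gscale B) f \<longleftrightarrow>
     (\<forall>x y. f (x + y) = f x + f y) \<and> (\<forall>c x. f (gscale B c x) = gscale B c (f x))"
  using vector_space_axioms by (simp add: Vector_Spaces.linear_iff)

lemma finite_dimensional: obtains S where "finite S" "span S = UNIV"
  using algebra by (auto simp: graded_algebra_def graded_space_def)

lemma subspace_gcomp: "subspace (gcomp B g)"
  using algebra by (auto simp: graded_algebra_def graded_space_def)

lemmas gcomp_closed = subspace_0[OF subspace_gcomp] subspace_add[OF subspace_gcomp]
  subspace_diff[OF subspace_gcomp] subspace_neg[OF subspace_gcomp] subspace_scale[OF subspace_gcomp]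

lemma unit_gcomp: "gunit B \<in> gcomp B 0" and unit_neq_0: "gunit B \<noteq> 0"
  using algebra by (auto simp: graded_algebra_def graded_space_def)

lemma bilinear_mult: "bilinear_law B \<mu>"
  using algebra by (simp add: graded_algebra_def linear_iff_additive bilinear_law_def)

lemma mult_assoc: "\<mu> (\<mu> x y) z = \<mu> x (\<mu> y z)"
  and mult_unit: "\<mu> (gunit B) x = x" "\<mu> x (gunit B) = x"
  and mult_graded: "x \<in> gcomp B g \<Longrightarrow> y \<in> gcomp B h \<Longrightarrow> \<mu> x y \<in> gcomp B (g + h)"
  using algebra by (auto simp: graded_algebra_def unital_graded_mult_def)

lemma gproj_eqI:
  assumes "\<And>h. c h \<in> gcomp B h" "x = (\<Sum>h\<in>UNIV. c h)"
  shows "gproj B g x = c g"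
proof -
  have "\<exists>!c. (\<forall>h. c h \<in> gcomp B h) \<and> x = (\<Sum>h\<in>UNIV. c h)"
    using algebra unfolding graded_algebra_def graded_space_def by blast
  then have "(THE c. (\<forall>h. c h \<in> gcomp B h) \<and> x = (\<Sum>h\<in>UNIV. c h)) = c"
    using assms by (intro the1_equality) blast+
  then show ?thesis by (simp add: gproj_def)
qed

lemma gproj_decomposition:
  "gproj B g x \<in> gcomp B g" "(\<Sum>h\<in>UNIV. gproj B h x) = x"
proof -
  obtain c where c: "\<And>h. c h \<in> gcomp B h" "x = (\<Sum>h\<in>UNIV. c h)"
    using algebra unfolding graded_algebra_def graded_space_def by metis
  have "gproj B h x = c h" for h using c by (rule gproj_eqI)
  then show "gproj B g x \<in> gcomp B g" "(\<Sum>h\<in>UNIV. gproj B h x) = x" using c by simp_all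
qed

lemma gproj_homogeneous: "x \<in> gcomp B g \<Longrightarrow> gproj B g x = x"
  by (rule gproj_eqI[of "\<lambda>h. if h = g then x else 0" x g, simplified]) (auto simp: gcomp_closed)

lemma gproj_add: "gproj B g (x + y) = gproj B g x + gproj B g y"
  by (rule gproj_eqI) (simp_all add: gcomp_closed gproj_decomposition(1) sum.distrib
      gproj_decomposition(2)[of x] gproj_decomposition(2)[of y])

lemma gproj_scale: "gproj B g (gscale B c x) = gscale B c (gproj B g x)"
  by (rule gproj_eqI) (simp_all add: gcomp_closed gproj_decomposition(1)
      gproj_decomposition(2)[of x] flip: scale_sum_right)

lemma cochains2_iff:
  "\<psi> \<in> cochains B 2 \<longleftrightarrow>
     (\<forall>xs. length xs \<noteq> 2 \<longrightarrow> \<psi> xs = 0) \<and> bilinear_law B (binary \<psi>) \<and>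
     (\<forall>g h. \<forall>x\<in>gcomp B g. \<forall>y\<in>gcomp B h. \<psi> [x, y] \<in> gcomp B (g + h)) \<and>
     (\<forall>x. \<psi> [gunit B, x] = 0 \<and> \<psi> [x, gunit B] = 0)" (is "?l \<longleftrightarrow> ?r")
proof -
  have len: "length xs = 2 \<longleftrightarrow> (\<exists>x y. xs = [x, y])" for xs :: "'v list"
    by (auto simp: numeral_2_eq_2 length_Suc_conv)
  have lin: "(\<forall>xs i. length xs = 2 \<and> i < 2 \<longrightarrow>
      Vector_Spaces.linear (gscale B) (gscale B) (\<lambda>x. \<psi> (xs[i := x]))) \<longleftrightarrow> bilinear_law B (binary \<psi>)"
    (is "?a = ?b")
  proof
    assume a: ?a
    have "\<psi> [x + y, z] = \<psi> [x, z] + \<psi> [y, z]" "\<psi> [z, x + y] = \<psi> [z, x] + \<psi> [z, y]"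
      "\<psi> [gscale B c x, z] = gscale B c (\<psi> [x, z])" "\<psi> [z, gscale B c x] = gscale B c (\<psi> [z, x])"
      for x y z c
      using a[rule_format, of "[z, z]" 0] a[rule_format, of "[z, z]" 1]
      by (simp_all add: linear_iff_additive)
    then show ?b by (simp add: bilinear_law_def)
  qed (auto simp: len less_2_cases_iff linear_iff_additive bilinear_law_def)
  have gr: "(\<forall>gs xs. length xs = 2 \<and> list_all2 (\<lambda>g x. x \<in> gcomp B g) gs xs \<longrightarrow>
           \<psi> xs \<in> gcomp B (sum_list gs)) \<longleftrightarrow>
       (\<forall>g h. \<forall>x\<in>gcomp B g. \<forall>y\<in>gcomp B h. \<psi> [x, y] \<in> gcomp B (g + h))" (is "?a = ?b")
  proof
    assume a: ?a
    show ?b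
    proof (intro allI ballI)
      fix g h x y assume "x \<in> gcomp B g" "y \<in> gcomp B h"
      then show "\<psi> [x, y] \<in> gcomp B (g + h)" using a[rule_format, of "[x, y]" "[g, h]"] by simp
    qed
  qed (auto simp: len list_all2_Cons2)
  have nrm: "(\<forall>xs. length xs = 2 \<and> gunit B \<in> set xs \<longrightarrow> \<psi> xs = 0) \<longleftrightarrow>
      (\<forall>x. \<psi> [gunit B, x] = 0 \<and> \<psi> [x, gunit B] = 0)"
    by (auto simp: len)
  show ?thesis
    unfolding cochains_def multilinear_maps_def mem_Collect_eq lin gr nrm by blast
qed

lemma cochains2D:
  assumes "\<psi> \<in> cochains B 2"
  shows "length xs \<noteq> 2 \<Longrightarrow> \<psi> xs = 0" and "bilinear_law B (binary \<psi>)"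
    and "x \<in> gcomp B g \<Longrightarrow> y \<in> gcomp B h \<Longrightarrow> \<psi> [x, y] \<in> gcomp B (g + h)"
    and "\<psi> [gunit B, x] = 0" "\<psi> [x, gunit B] = 0"
  using assms unfolding cochains2_iff by blast+

lemma cochains3I:
  assumes off: "\<And>xs. length xs \<noteq> 3 \<Longrightarrow> c xs = 0"
    and "\<And>x x' y z. c [x + x', y, z] = c [x, y, z] + c [x', y, z]"
      "\<And>x y y' z. c [x, y + y', z] = c [x, y, z] + c [x, y', z]"
      "\<And>x y z z'. c [x, y, z + z'] = c [x, y, z] + c [x, y, z']"
    and "\<And>r x y z. c [gscale B r x, y, z] = gscale B r (c [x, y, z])"
      "\<And>r x y z. c [x, gscale B r y, z] = gscale B r (c [x, y, z])"
      "\<And>r x y z. c [x, y, gscale B r z] = gscale B r (c [x, y, z])"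
    and gr: "\<And>f g h x y z. x \<in> gcomp B f \<Longrightarrow> y \<in> gcomp B g \<Longrightarrow> z \<in> gcomp B h \<Longrightarrow>
      c [x, y, z] \<in> gcomp B (f + (g + h))"
    and nrm: "\<And>x y. c [gunit B, x, y] = 0" "\<And>x y. c [x, gunit B, y] = 0"
      "\<And>x y. c [x, y, gunit B] = 0"
  shows "c \<in> cochains B 3"
proof -
  have len: "length xs = 3 \<longleftrightarrow> (\<exists>x y z. xs = [x, y, z])" for xs :: "'v list"
    by (auto simp: numeral_3_eq_3 length_Suc_conv)
  have lin: "Vector_Spaces.linear (gscale B) (gscale B) (\<lambda>x. c (xs[i := x]))"
    if xs: "length xs = 3" and i: "i < 3" for xs i
  proof -
    obtain x y z where xs: "xs = [x, y, z]" using xs len by blast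
    from i consider "i = 0" | "i = 1" | "i = 2" by linarith
    then show ?thesis by cases (simp_all add: xs linear_iff_additive assms(2-7))
  qed
  moreover have "c xs \<in> gcomp B (sum_list gs)"
    if "length xs = 3" "list_all2 (\<lambda>g x. x \<in> gcomp B g) gs xs" for gs xs
    using that by (auto simp: len list_all2_Cons2 intro!: gr)
  moreover have "c xs = 0" if "length xs = 3" "gunit B \<in> set xs" for xs
    using that by (auto simp: len nrm)
  ultimately show ?thesis
    unfolding cochains_def multilinear_maps_def using off by blast
qed

lemma d_Hoch_cochain:
  assumes \<psi>: "\<psi> \<in> cochains B 2"
  shows "d_Hoch \<mu> \<psi> \<in> cochains B 3"
proof -
  note bil = bilinear_law_simps[OF bilinear_mult] bilinear_law_simps[OF cochains2D(2)[OF \<psi>]]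
  show ?thesis
  proof (rule cochains3I)
    show "d_Hoch \<mu> \<psi> xs = 0" if "length xs \<noteq> 3" for xs
      using that by (auto simp: d_Hoch_def split: list.split)
    fix f g h x y z assume h: "x \<in> gcomp B f" "y \<in> gcomp B g" "z \<in> gcomp B h"
    have "\<psi> [\<mu> x y, z] \<in> gcomp B (f + (g + h))" "\<psi> [x, \<mu> y z] \<in> gcomp B (f + (g + h))"
      "\<mu> (\<psi> [x, y]) z \<in> gcomp B (f + (g + h))" "\<mu> x (\<psi> [y, z]) \<in> gcomp B (f + (g + h))"
      using h mult_graded cochains2D(3)[OF \<psi>] by (metis add.assoc)+
    then show "d_Hoch \<mu> \<psi> [x, y, z] \<in> gcomp B (f + (g + h))"
      by (simp add: d_Hoch_def gcomp_closed)
  qed (simp_all add: d_Hoch_def bil scale_right_distrib scale_right_diff_distrib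
      cochains2D(4,5)[OF \<psi>] mult_unit)
qed

lemma Q_ass_cochain:
  assumes \<phi>: "\<phi> \<in> cochains B 2"
  shows "Q_ass \<phi> \<in> cochains B 3"
proof -
  note bil = bilinear_law_simps[OF cochains2D(2)[OF \<phi>]]
  show ?thesis
  proof (rule cochains3I)
    show "Q_ass \<phi> xs = 0" if "length xs \<noteq> 3" for xs
      using that by (auto simp: Q_ass_def split: list.split)
    fix f g h x y z assume h: "x \<in> gcomp B f" "y \<in> gcomp B g" "z \<in> gcomp B h"
    have "\<phi> [\<phi> [x, y], z] \<in> gcomp B (f + (g + h))" "\<phi> [x, \<phi> [y, z]] \<in> gcomp B (f + (g + h))"
      using h cochains2D(3)[OF \<phi>] by (metis add.assoc)+
    then show "Q_ass \<phi> [x, y, z] \<in> gcomp B (f + (g + h))"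
      by (simp add: Q_ass_def gcomp_closed)
  qed (simp_all add: Q_ass_def bil scale_right_diff_distrib cochains2D(4,5)[OF \<phi>])
qed

end

section \<open>Laws over truncated polynomial rings\<close>

lemma tlaw_in_tspace: "tlaw n ms a b \<in> tspace n"
  by (simp add: tlaw_def tspace_def)

text \<open>
  Solving \<open>p + i + j = l\<close> for \<open>j\<close> turns the sum over triples into an iterated sum, which rewriting can
  evaluate for a given \<open>l\<close>.
\<close>

lemma tlaw_nested:
  assumes "l < n"
  shows "tlaw n ms a b l =
    (\<Sum>p<length ms. if p \<le> l then \<Sum>i\<le>l - p. (ms ! p) (a i) (b (l - p - i)) else 0)"
proof -
  have "tlaw n ms a b l = (\<Sum>(p, i, j)\<in>{(p, i, j). p < length ms \<and> p + i + j = l}. (ms ! p) (a i) (b j))"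
    using assms by (simp add: tlaw_def)
  also have "\<dots> = (\<Sum>(p, i)\<in>Sigma {p. p < length ms \<and> p \<le> l} (\<lambda>p. {..l - p}). (ms ! p) (a i) (b (l - p - i)))"
    by (rule sum.reindex_bij_witness[where i = "\<lambda>(p, i). (p, i, l - p - i)" and j = "\<lambda>(p, i, j). (p, i)"])
      auto
  also have "\<dots> = (\<Sum>p\<in>{p. p < length ms \<and> p \<le> l}. \<Sum>i\<le>l - p. (ms ! p) (a i) (b (l - p - i)))"
    by (subst sum.Sigma) auto
  also have "\<dots> = (\<Sum>p<length ms. if p \<le> l then \<Sum>i\<le>l - p. (ms ! p) (a i) (b (l - p - i)) else 0)"
    by (rule sum.mono_neutral_cong_left) auto
  finally show ?thesis .
qed

lemma tlaw_3_coeffs: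
  "tlaw 3 [m0, m1, m2] a b 0 = m0 (a 0) (b 0)"
  "tlaw 3 [m0, m1, m2] a b (Suc 0) = m0 (a 0) (b (Suc 0)) + m0 (a (Suc 0)) (b 0) + m1 (a 0) (b 0)"
  "tlaw 3 [m0, m1, m2] a b 2 = m0 (a 0) (b 2) + m0 (a (Suc 0)) (b (Suc 0)) + m0 (a 2) (b 0)
     + m1 (a 0) (b (Suc 0)) + m1 (a (Suc 0)) (b 0) + m2 (a 0) (b 0)"
  by (simp_all add: tlaw_nested numeral_2_eq_2 add.assoc)

lemma tlaw_3_zero: "tlaw 3 [m0, m1] = tlaw 3 [m0, m1, \<lambda>x y. 0]"
proof (intro ext)
  fix a b l
  show "tlaw 3 [m0, m1] a b l = tlaw 3 [m0, m1, \<lambda>x y. 0] a b l"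
    by (cases "l < 3") (simp_all add: tlaw_nested, simp add: tlaw_def)
qed

lemma tlaw_2_eq: "tlaw 2 [m0, m1] a b = tcut 2 (tlaw 3 [m0, m1, m2] a b)"
proof
  fix l
  consider "l = 0" | "l = Suc 0" | "\<not> l < 2" by linarith
  then show "tlaw 2 [m0, m1] a b l = tcut 2 (tlaw 3 [m0, m1, m2] a b) l"
    by cases (simp_all add: tlaw_nested tcut_def, simp add: tlaw_def)
qed

lemma tlaw_2_coeffs:
  "tlaw 2 [m0, m1] a b 0 = m0 (a 0) (b 0)"
  "tlaw 2 [m0, m1] a b (Suc 0) = m0 (a 0) (b (Suc 0)) + m0 (a (Suc 0)) (b 0) + m1 (a 0) (b 0)"
  by (simp_all add: tlaw_2_eq[of _ _ _ _ m1] tcut_def tlaw_3_coeffs)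

lemma tspace_3_eqI:
  assumes "a \<in> tspace 3" "b \<in> tspace 3" "a 0 = b 0" "a (Suc 0) = b (Suc 0)" "a 2 = b 2"
  shows "a = b"
proof
  fix l
  consider "l = 0" | "l = Suc 0" | "l = 2" | "l \<ge> 3" by linarith
  then show "a l = b l" using assms by cases (auto simp: tspace_def)
qed

lemma tspace_2_eqI:
  assumes "a \<in> tspace 2" "b \<in> tspace 2" "a 0 = b 0" "a (Suc 0) = b (Suc 0)"
  shows "a = b"
proof
  fix l
  consider "l = 0" | "l = Suc 0" | "l \<ge> 2" by linarith
  then show "a l = b l" using assms by cases (auto simp: tspace_def)
qed

lemma tcomp_3_iff: "a \<in> tcomp B 3 g \<longleftrightarrow>
    a \<in> tspace 3 \<and> a 0 \<in> gcomp B g \<and> a (Suc 0) \<in> gcomp B g \<and> a 2 \<in> gcomp B g"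
proof -
  have "(\<forall>i<3. P i) \<longleftrightarrow> P 0 \<and> P (Suc 0) \<and> P 2" for P :: "nat \<Rightarrow> bool"
  proof
    assume *: "P 0 \<and> P (Suc 0) \<and> P 2"
    show "\<forall>i<3. P i"
    proof (intro allI impI)
      fix i :: nat assume "i < 3"
      then consider "i = 0" | "i = Suc 0" | "i = 2" by linarith
      then show "P i" using * by cases auto
    qed
  qed auto
  then show ?thesis by (simp add: tcomp_def)
qed

lemma tcomp_2_iff: "a \<in> tcomp B 2 g \<longleftrightarrow> a \<in> tspace 2 \<and> a 0 \<in> gcomp B g \<and> a (Suc 0) \<in> gcomp B g"
  by (auto simp: tcomp_def less_2_cases_iff)

lemma tlaw_add:
  assumes "\<And>m. m \<in> set ms \<Longrightarrow> bilinear_law B m"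
  shows "tlaw n ms (a + b) c = tlaw n ms a c + tlaw n ms b c"
    and "tlaw n ms c (a + b) = tlaw n ms c a + tlaw n ms c b"
proof -
  have add: "(ms ! p) (x + y) z = (ms ! p) x z + (ms ! p) y z"
    "(ms ! p) z (x + y) = (ms ! p) z x + (ms ! p) z y" if "p < length ms" for p x y z
    using bilinear_law_simps(1,2)[OF assms] that by auto
  have "(\<Sum>(p, i, j)\<in>{(p, i, j). p < length ms \<and> p + i + j = l}. (ms ! p) (a i + b i) (c j))
      = (\<Sum>(p, i, j)\<in>{(p, i, j). p < length ms \<and> p + i + j = l}. (ms ! p) (a i) (c j))
      + (\<Sum>(p, i, j)\<in>{(p, i, j). p < length ms \<and> p + i + j = l}. (ms ! p) (b i) (c j))" for l
    by (auto simp: add sum.distrib[symmetric] intro!: sum.cong)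
  then show "tlaw n ms (a + b) c = tlaw n ms a c + tlaw n ms b c"
    by (auto simp: tlaw_def fun_eq_iff)
  have "(\<Sum>(p, i, j)\<in>{(p, i, j). p < length ms \<and> p + i + j = l}. (ms ! p) (c i) (a j + b j))
      = (\<Sum>(p, i, j)\<in>{(p, i, j). p < length ms \<and> p + i + j = l}. (ms ! p) (c i) (a j))
      + (\<Sum>(p, i, j)\<in>{(p, i, j). p < length ms \<and> p + i + j = l}. (ms ! p) (c i) (b j))" for l
    by (auto simp: add sum.distrib[symmetric] intro!: sum.cong)
  then show "tlaw n ms c (a + b) = tlaw n ms c a + tlaw n ms c b"
    by (auto simp: tlaw_def fun_eq_iff)
qed

lemma (in graded_algebra_over) tlaw_tscale:
  assumes "\<And>m. m \<in> set ms \<Longrightarrow> bilinear_law B m"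
  shows "tlaw n ms (tscale B r a) b = tscale B r (tlaw n ms a b)"
    and "tlaw n ms a (tscale B r b) = tscale B r (tlaw n ms a b)"
proof -
  have scl: "(ms ! p) (gscale B r x) y = gscale B r ((ms ! p) x y)"
    "(ms ! p) x (gscale B r y) = gscale B r ((ms ! p) x y)" if "p < length ms" for p x y
    using bilinear_law_simps(3,4)[OF assms] that by auto
  show "tlaw n ms (tscale B r a) b = tscale B r (tlaw n ms a b)"
    "tlaw n ms a (tscale B r b) = tscale B r (tlaw n ms a b)"
    by (auto simp: tlaw_def tscale_def fun_eq_iff scl scale_sum_right intro!: sum.cong)
qed

text \<open>
  On \<open>B \<otimes> k[t]/(t\<^sup>3)\<close> the shift is multiplication by \<open>t\<close>, so this is the linearity of the law over
  \<open>k[t]\<close>.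
\<close>

lemma tlaw_tshift:
  fixes a b :: "nat \<Rightarrow> 'v::ab_group_add"
  assumes "bilinear_law B m0" "bilinear_law B m1" "bilinear_law B m2"
  shows "tlaw 3 [m0, m1, m2] (tshift 3 a) b = tshift 3 (tlaw 3 [m0, m1, m2] a b)"
    and "tlaw 3 [m0, m1, m2] a (tshift 3 b) = tshift 3 (tlaw 3 [m0, m1, m2] a b)"
proof -
  note zero = bilinear_law_simps(5,6)[OF assms(1)] bilinear_law_simps(5,6)[OF assms(2)]
    bilinear_law_simps(5,6)[OF assms(3)]
  have shift: "tshift 3 c \<in> tspace 3" "tshift 3 c 0 = 0" "tshift 3 c (Suc 0) = c 0"
    "tshift 3 c 2 = c (Suc 0)" for c :: "nat \<Rightarrow> 'v"
    by (auto simp: tshift_def tspace_def)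
  show "tlaw 3 [m0, m1, m2] (tshift 3 a) b = tshift 3 (tlaw 3 [m0, m1, m2] a b)"
    "tlaw 3 [m0, m1, m2] a (tshift 3 b) = tshift 3 (tlaw 3 [m0, m1, m2] a b)"
    by (rule tspace_3_eqI; simp add: tlaw_in_tspace shift tlaw_3_coeffs zero)+
qed

section \<open>Second-order lifts\<close>

lemma sum_fun_eval: "(\<Sum>i\<in>A. F i) l = (\<Sum>i\<in>A. F i l)"
  by (induction A rule: infinite_finite_induct) simp_all

lemma tconst_coeffs: "tconst x 0 = x" "tconst x (Suc l) = 0" "tconst x (numeral k) = 0"
  by (simp_all add: tconst_def)

lemma tconst_tspace: "0 < n \<Longrightarrow> tconst x \<in> tspace n"
  by (auto simp: tconst_def tspace_def)

context graded_algebra_over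
begin

lemma vector_space_base: "vector_space (\<lambda>c. gscale B (\<iota> c))"
  using embedding
  by unfold_locales (simp_all add: field_embedding_def scale_right_distrib scale_left_distrib)

lemma vector_space_tscale: "vector_space (\<lambda>c. tscale B (\<iota> c))"
  using embedding
  by unfold_locales
    (simp_all add: tscale_def fun_eq_iff field_embedding_def scale_right_distrib scale_left_distrib)

lemma base_algebra:
  "unital_graded_algebra (\<lambda>c. gscale B (\<iota> c)) UNIV (gcomp B) (gunit B) \<mu>"
proof -
  interpret base: vector_space "\<lambda>c. gscale B (\<iota> c)" by (rule vector_space_base)
  show ?thesis
  proof
    show "unital_graded_mult UNIV (gcomp B) (gunit B) \<mu>"
      using algebra by (simp add: graded_algebra_def)
    show "base.subspace (gcomp B g)" for g
      by (auto simp: base.subspace_def gcomp_closed)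
  qed (simp_all add: bilinear_law_simps[OF bilinear_mult])
qed

lemma truncated_algebra:
  assumes "unital_graded_mult (tspace n) (tcomp B n) (tconst (gunit B)) (tlaw n ms)"
    and "\<And>m. m \<in> set ms \<Longrightarrow> bilinear_law B m"
  shows "unital_graded_algebra (\<lambda>c. tscale B (\<iota> c)) (tspace n) (tcomp B n) (tconst (gunit B)) (tlaw n ms)"
proof -
  interpret ext: vector_space "\<lambda>c. tscale B (\<iota> c)" by (rule vector_space_tscale)
  show ?thesis
  proof
    show "ext.subspace (tcomp B n g)" for g
      by (auto simp: ext.subspace_def tcomp_def tspace_def tscale_def gcomp_closed)
    show "tcomp B n g \<subseteq> tspace n" for g by (auto simp: tcomp_def)
  qed (simp_all add: assms(1) tlaw_add[OF assms(2)] tlaw_tscale[OF assms(2)])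
qed

lemma first_order_mult:
  assumes \<phi>: "\<phi> \<in> cochains B 2" and cocycle: "d_Hoch \<mu> \<phi> = 0"
  shows "unital_graded_mult (tspace 2) (tcomp B 2) (tconst (gunit B)) (tlaw 2 [\<mu>, binary \<phi>])"
    (is "unital_graded_mult _ _ _ ?M")
proof -
  note bil = bilinear_law_simps[OF bilinear_mult] bilinear_law_simps[OF cochains2D(2)[OF \<phi>]]
  have c: "\<phi> [\<mu> x y, z] = \<phi> [x, \<mu> y z] - \<mu> (\<phi> [x, y]) z + \<mu> x (\<phi> [y, z])" for x y z
    using fun_cong[OF cocycle, of "[x, y, z]"] by (simp add: d_Hoch_def algebra_simps)
  have "?M (?M a b) c = ?M a (?M b c)" for a b c
    by (rule tspace_2_eqI) (simp_all add: tlaw_in_tspace tlaw_2_coeffs bil mult_assoc c)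
  moreover have "?M (tconst (gunit B)) a = a" "?M a (tconst (gunit B)) = a" if "a \<in> tspace 2" for a
    using that cochains2D(4,5)[OF \<phi>]
    by (auto intro!: tspace_2_eqI simp: tlaw_in_tspace tlaw_2_coeffs tconst_coeffs bil mult_unit)
  moreover have "?M a b \<in> tcomp B 2 (g + h)" if "a \<in> tcomp B 2 g" "b \<in> tcomp B 2 h" for a b g h
    using that
    by (auto simp: tcomp_2_iff tlaw_in_tspace tlaw_2_coeffs
        intro!: gcomp_closed mult_graded cochains2D(3)[OF \<phi>])
  moreover have "tconst (gunit B) \<in> tcomp B 2 0"
    by (simp add: tcomp_2_iff tconst_tspace tconst_coeffs unit_gcomp gcomp_closed)
  ultimately show ?thesis
    by (auto simp: unital_graded_mult_def tlaw_in_tspace tconst_tspace)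
qed

text \<open>
  Every term of the associator of \<open>\<mu> + t \<phi> + t\<^sup>2 \<psi>\<close> vanishes by the associativity of \<open>\<mu>\<close> or by the cocycle
  condition on \<open>\<phi>\<close>, except for the value of \<open>d\<psi> + Q\<close> at the constant coefficients of the arguments,
  which stands at \<open>t\<^sup>2\<close>.  Grading and unit come for free, since \<open>\<phi>\<close> and \<open>\<psi>\<close> are normalized graded cochains.
\<close>

lemma second_order_mult_iff:
  assumes \<phi>: "\<phi> \<in> cochains B 2" and cocycle: "d_Hoch \<mu> \<phi> = 0" and \<psi>: "\<psi> \<in> cochains B 2"
  shows "unital_graded_mult (tspace 3) (tcomp B 3) (tconst (gunit B)) (tlaw 3 [\<mu>, binary \<phi>, binary \<psi>])
    \<longleftrightarrow> d_Hoch \<mu> \<psi> = - Q_ass \<phi>" (is "unital_graded_mult _ _ _ ?M \<longleftrightarrow> _")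
proof
  note bil = bilinear_law_simps[OF bilinear_mult] bilinear_law_simps[OF cochains2D(2)[OF \<phi>]]
    bilinear_law_simps[OF cochains2D(2)[OF \<psi>]]
  assume "unital_graded_mult (tspace 3) (tcomp B 3) (tconst (gunit B)) ?M"
  then have assoc: "?M (?M (tconst x) (tconst y)) (tconst z) 2 = ?M (tconst x) (?M (tconst y) (tconst z)) 2"
    for x y z by (simp add: unital_graded_mult_def tconst_tspace)
  show "d_Hoch \<mu> \<psi> = - Q_ass \<phi>"
  proof
    fix xs
    show "d_Hoch \<mu> \<psi> xs = (- Q_ass \<phi>) xs"
    proof (cases "length xs = 3")
      case True
      then obtain x y z where "xs = [x, y, z]"
        by (auto simp: numeral_3_eq_3 length_Suc_conv)
      then show ?thesis
        using assoc[of x y z]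
        by (simp add: d_Hoch_def Q_ass_def tlaw_3_coeffs tconst_coeffs bil algebra_simps)
    next
      case False
      then show ?thesis by (auto simp: d_Hoch_def Q_ass_def split: list.split)
    qed
  qed
next
  note bil = bilinear_law_simps[OF bilinear_mult] bilinear_law_simps[OF cochains2D(2)[OF \<phi>]]
    bilinear_law_simps[OF cochains2D(2)[OF \<psi>]]
  assume obs: "d_Hoch \<mu> \<psi> = - Q_ass \<phi>"
  have c: "\<phi> [\<mu> x y, z] = \<phi> [x, \<mu> y z] - \<mu> (\<phi> [x, y]) z + \<mu> x (\<phi> [y, z])" for x y z
    using fun_cong[OF cocycle, of "[x, y, z]"] by (simp add: d_Hoch_def algebra_simps)
  have o: "\<psi> [\<mu> x y, z] = \<psi> [x, \<mu> y z] - \<mu> (\<psi> [x, y]) z + \<mu> x (\<psi> [y, z])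
      - \<phi> [\<phi> [x, y], z] + \<phi> [x, \<phi> [y, z]]" for x y z
    using fun_cong[OF obs, of "[x, y, z]"] by (simp add: d_Hoch_def Q_ass_def algebra_simps)
  have "?M (?M a b) c = ?M a (?M b c)" for a b c
    by (rule tspace_3_eqI)
      (simp_all add: tlaw_in_tspace tlaw_3_coeffs bil mult_assoc c o)
  moreover have "?M (tconst (gunit B)) a = a" "?M a (tconst (gunit B)) = a" if "a \<in> tspace 3" for a
    using that cochains2D(4,5)[OF \<phi>] cochains2D(4,5)[OF \<psi>]
    by (auto intro!: tspace_3_eqI simp: tlaw_in_tspace tlaw_3_coeffs tconst_coeffs bil mult_unit)
  moreover have "?M a b \<in> tcomp B 3 (g + h)" if "a \<in> tcomp B 3 g" "b \<in> tcomp B 3 h" for a b g h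
    using that
    by (auto simp: tcomp_3_iff tlaw_in_tspace tlaw_3_coeffs
        intro!: gcomp_closed mult_graded cochains2D(3)[OF \<phi>] cochains2D(3)[OF \<psi>])
  moreover have "tconst (gunit B) \<in> tcomp B 3 0"
    by (simp add: tcomp_3_iff tconst_tspace tconst_coeffs unit_gcomp gcomp_closed)
  ultimately show "unital_graded_mult (tspace 3) (tcomp B 3) (tconst (gunit B)) ?M"
    by (auto simp: unital_graded_mult_def tlaw_in_tspace tconst_tspace)
qed

text \<open>
  For a Hochschild cocycle \<open>\<phi>\<close> the law \<open>\<mu> + t \<phi>\<close> is associative over \<open>k[t]/(t\<^sup>2)\<close>, so the first differential of
  a polynomial in the direction \<open>\<phi>\<close> does not see the bracketing.
\<close>

lemma Z2_bracketing_independent: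
  assumes "bracketing \<beta>" "bracketing \<beta>'"
  shows "Z2 \<iota> B \<mu> \<beta> I = Z2 \<iota> B \<mu> \<beta>' I"
proof -
  have "D_law \<iota> B \<mu> \<beta> f \<phi> a = D_law \<iota> B \<mu> \<beta>' f \<phi> a"
    if \<phi>: "\<phi> \<in> cochains B 2" "d_Hoch \<mu> \<phi> = 0" for f \<phi> a
  proof -
    interpret ext: unital_graded_algebra "\<lambda>c. tscale B (\<iota> c)" "tspace 2" "tcomp B 2"
      "tconst (gunit B)" "tlaw 2 [\<mu>, binary \<phi>]"
      by (rule truncated_algebra[OF first_order_mult[OF \<phi>]])
        (auto simp: bilinear_mult cochains2D(2)[OF \<phi>(1)])
    show ?thesis
      by (simp add: D_law_def tlaw_eval_def ext.law_eval_eq_assoc_eval assms tconst_tspace)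
  qed
  then show ?thesis by (auto simp: Z2_def)
qed

text \<open>
  The operation \<open>m2\<close> carries the factor \<open>t\<^sup>2\<close>, so in a monomial it contributes to the coefficient of
  \<open>t\<^sup>2\<close> only when it is used at one node and \<open>\<mu>\<close> at all others.  The sum of these terms is the first
  differential in the direction \<open>m2\<close>, and the remaining terms are those of the law \<open>\<mu> + t m1\<close>.
\<close>

lemma bracketed_eval_coeffs:
  fixes a :: "'x \<Rightarrow> 'v" and t :: "'x bracketed" and m1 m2 :: "'v \<Rightarrow> 'v \<Rightarrow> 'v"
  defines "X \<equiv> bracketed_eval (tlaw 3 [\<mu>, m1, m2]) (\<lambda>x. tconst (a x)) t"
    and "Y \<equiv> bracketed_eval (tlaw 3 [\<mu>, m1]) (\<lambda>x. tconst (a x)) t"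
    and "Z \<equiv> bracketed_eval (tlaw 2 [\<mu>, m2]) (\<lambda>x. tconst (a x)) t"
    and "W \<equiv> bracketed_eval (tlaw 2 [\<mu>, m1]) (\<lambda>x. tconst (a x)) t"
  shows "X 0 = bracketed_eval \<mu> a t" "X (Suc 0) = W (Suc 0)" "X 2 = Y 2 + Z (Suc 0)"
    "X \<in> tspace 3"
proof -
  note mu = bilinear_law_simps(1,2)[OF bilinear_mult]
  have "X 0 = bracketed_eval \<mu> a t \<and> Y 0 = bracketed_eval \<mu> a t \<and> Z 0 = bracketed_eval \<mu> a t \<and>
      W 0 = bracketed_eval \<mu> a t \<and> X (Suc 0) = W (Suc 0) \<and> Y (Suc 0) = W (Suc 0) \<and>
      X 2 = Y 2 + Z (Suc 0)"
    unfolding X_def Y_def Z_def W_def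
    by (induction t)
      (simp_all add: tconst_coeffs tlaw_3_zero tlaw_3_coeffs tlaw_2_coeffs mu add_ac)
  moreover have "X \<in> tspace 3"
    unfolding X_def by (cases t) (simp_all add: tconst_tspace tlaw_in_tspace)
  ultimately show "X 0 = bracketed_eval \<mu> a t" "X (Suc 0) = W (Suc 0)" "X 2 = Y 2 + Z (Suc 0)"
    "X \<in> tspace 3" by auto
qed

lemma tlaw_eval_coeffs:
  fixes \<beta> :: "('g, 'f) free_alg \<Rightarrow> 'g word \<Rightarrow> (nat \<times> 'g) bracketed" and f :: "('g, 'f) free_alg"
    and \<phi> \<psi> :: "'v list \<Rightarrow> 'v"
  defines "X \<equiv> \<lambda>a. tlaw_eval \<iota> B 3 [\<mu>, binary \<phi>, binary \<psi>] \<beta> f a"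
  shows "X a 0 = law_eval (\<lambda>c. gscale B (\<iota> c)) (gunit B) \<mu> \<beta> f a"
    and "X a (Suc 0) = D_law \<iota> B \<mu> \<beta> f \<phi> a"
    and "X a 2 = Q_law \<iota> B \<mu> \<beta> f \<phi> a + D_law \<iota> B \<mu> \<beta> f \<psi> a"
    and "X a \<in> tspace 3"
proof -
  note defs = X_def tlaw_eval_def law_eval_def sum_fun_eval tscale_def
  note coeffs = bracketed_eval_coeffs[where ?m1.0 = "binary \<phi>" and ?m2.0 = "binary \<psi>" and a = a]
  show "X a 0 = law_eval (\<lambda>c. gscale B (\<iota> c)) (gunit B) \<mu> \<beta> f a"
    unfolding defs by (intro sum.cong) (simp_all add: coeffs tconst_coeffs)
  show "X a (Suc 0) = D_law \<iota> B \<mu> \<beta> f \<phi> a"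
    unfolding D_law_def One_nat_def defs by (intro sum.cong) (simp_all add: coeffs tconst_coeffs)
  show "X a 2 = Q_law \<iota> B \<mu> \<beta> f \<phi> a + D_law \<iota> B \<mu> \<beta> f \<psi> a"
    unfolding Q_law_def D_law_def One_nat_def defs sum.distrib[symmetric]
    by (intro sum.cong) (simp_all add: coeffs tconst_coeffs scale_right_distrib)
  have "(if w = [] then tconst (gunit B)
      else bracketed_eval (tlaw 3 [\<mu>, binary \<phi>, binary \<psi>]) (\<lambda>x. tconst (a x)) (\<beta> f w)) l = 0"
    if "3 \<le> l" for w l
    using coeffs(4)[of "\<beta> f w"] that tconst_tspace[of 3 "gunit B"] by (simp add: tspace_def)
  then show "X a \<in> tspace 3" by (simp add: tspace_def defs)
qed

lemma tseq_decomposition: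
  assumes "a \<in> tspace 3"
  shows "a = tconst (a 0) + (tshift 3 (tconst (a (Suc 0))) + tshift 3 (tshift 3 (tconst (a 2))))"
proof
  fix l
  consider "l = 0" | "l = Suc 0" | "l = 2" | "l \<ge> 3" by linarith
  then show "a l = (tconst (a 0) + (tshift 3 (tconst (a (Suc 0))) + tshift 3 (tshift 3 (tconst (a 2))))) l"
    using assms by cases (simp_all add: tconst_def tshift_def tspace_def)
qed

lemma tshift_linear:
  "tshift n (a + b) = tshift n a + tshift n b" "tshift n 0 = 0"
  "tscale B c (tshift n a) = tshift n (tscale B c a)"
  by (auto simp: tshift_def tscale_def)

text \<open>
  The evaluation of a multilinear polynomial is multilinear over \<open>k[t]\<close>, so an argument
  \<open>x\<^sub>0 + t x\<^sub>1 + t\<^sup>2 x\<^sub>2\<close> can be split into constants.  The induction is on the set of variables whose value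
  is not yet constant.
\<close>

lemma identity_on_constants:
  assumes F: "multilinear_generator F" and \<beta>: "bracketing \<beta>"
    and bil: "bilinear_law B m0" "bilinear_law B m1" "bilinear_law B m2"
    and const: "\<And>a. graded_assignment (gcomp B) a \<Longrightarrow> tlaw_eval \<iota> B 3 [m0, m1, m2] \<beta> (snd F) a = 0"
    and b: "graded_assignment (tcomp B 3) b"
  shows "law_eval (\<lambda>c. tscale B (\<iota> c)) (tconst (gunit B)) (tlaw 3 [m0, m1, m2]) \<beta> (snd F) b = 0"
proof -
  let ?E = "\<lambda>b. law_eval (\<lambda>c. tscale B (\<iota> c)) (tconst (gunit B)) (tlaw 3 [m0, m1, m2]) \<beta> (snd F) b"
  have law_bil: "bilinear_law B m" if "m \<in> set [m0, m1, m2]" for m using that bil by auto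
  have scale_add: "tscale B c (x + y) = tscale B c x + tscale B c y" for c x y
    by (simp add: tscale_def fun_eq_iff scale_right_distrib)
  have add: "?E (b(x := y + z)) = ?E (b(x := y)) + ?E (b(x := z))" if "x \<in> set (fst F)" for b x y z
    by (rule law_eval_add[OF F \<beta> that]) (rule tlaw_add[OF law_bil] scale_add; assumption)+
  have shift: "?E (b(x := tshift 3 y)) = tshift 3 (?E (b(x := y)))" if "x \<in> set (fst F)" for b x y
    by (rule law_eval_operator[OF F \<beta> that])
      (simp_all only: tlaw_tshift[OF bil] tshift_linear)
  have vanish: "?E b = 0" if "finite V" "graded_assignment (tcomp B 3) b"
    "\<And>x. x \<notin> V \<Longrightarrow> \<exists>y. b x = tconst y" for V b
    using that
  proof (induction V arbitrary: b rule: finite_induct)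
    case empty
    then have "b x = tconst (b x 0)" for x by (metis empty_iff tconst_coeffs(1))
    then have "?E b = tlaw_eval \<iota> B 3 [m0, m1, m2] \<beta> (snd F) (\<lambda>x. b x 0)"
      by (simp add: tlaw_eval_def flip: fun_eq_iff)
    also have "\<dots> = 0"
      using empty.prems(1) by (intro const) (auto simp: graded_assignment_def tcomp_3_iff)
    finally show ?case .
  next
    case (insert x V)
    have bx: "b x \<in> tcomp B 3 (snd x)"
      using insert.prems(1) by (cases x) (auto simp: graded_assignment_def)
    have upd: "?E (b(x := tconst y)) = 0" if "y \<in> gcomp B (snd x)" for y
    proof (rule insert.IH)
      show "graded_assignment (tcomp B 3) (b(x := tconst y))"
        using insert.prems(1) that
        by (auto simp: graded_assignment_def tcomp_3_iff tconst_tspace tconst_coeffs gcomp_closed)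
      show "\<exists>y'. (b(x := tconst y)) z = tconst y'" if "z \<notin> V" for z
        using insert.prems(2)[of z] that by (cases "z = x") auto
    qed
    show ?case
    proof (cases "x \<in> set (fst F)")
      case True
      let ?y0 = "tconst (b x 0)" and ?y1 = "tconst (b x (Suc 0))" and ?y2 = "tconst (b x 2)"
      have "b x \<in> tspace 3" using bx by (simp add: tcomp_3_iff)
      then have "b = b(x := ?y0 + (tshift 3 ?y1 + tshift 3 (tshift 3 ?y2)))"
        by (simp flip: tseq_decomposition)
      then have "?E b = ?E (b(x := ?y0)) + (tshift 3 (?E (b(x := ?y1)))
          + tshift 3 (tshift 3 (?E (b(x := ?y2)))))"
        by (metis add[OF True] shift[OF True])
      also have "\<dots> = 0" using bx by (simp add: upd tcomp_3_iff tshift_linear)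
      finally show ?thesis .
    next
      case False
      have "?E b = ?E (b(x := tconst 0))" using False by (intro law_eval_cong[OF F \<beta>]) auto
      then show ?thesis using upd gcomp_closed(1) by simp
    qed
  qed
  \<comment> \<open>The assignment is made constant outside the finitely many variables of \<open>F\<close>.\<close>
  have "?E (\<lambda>x. if x \<in> set (fst F) then b x else tconst 0) = 0"
  proof (rule vanish[of "set (fst F)"])
    show "graded_assignment (tcomp B 3) (\<lambda>x. if x \<in> set (fst F) then b x else tconst 0)"
      using b by (auto simp: graded_assignment_def tcomp_3_iff tconst_tspace tconst_coeffs gcomp_closed)
  qed auto
  moreover have "?E b = ?E (\<lambda>x. if x \<in> set (fst F) then b x else tconst 0)"
    by (rule law_eval_cong[OF F \<beta>]) simp
  ultimately show ?thesis by simp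
qed

lemma arg_assignment_graded: "graded_assignment (gcomp B) (arg_assignment B vs bs)"
  by (auto simp: graded_assignment_def arg_assignment_def gproj_decomposition gcomp_closed
      split: option.split)

text \<open>
  Extending a map by zero to the other homogeneous components loses nothing: every argument list is
  projected to a graded assignment, and a graded assignment is recovered from its list of values.
\<close>

lemma D_gen_eq_iff:
  assumes F: "multilinear_generator F" and \<beta>: "bracketing \<beta>"
  shows "D_gen \<iota> B \<mu> \<beta> F \<psi> = - Q_gen \<iota> B \<mu> \<beta> F \<phi> \<longleftrightarrow>
    (\<forall>a. graded_assignment (gcomp B) a \<longrightarrow> Q_law \<iota> B \<mu> \<beta> (snd F) \<phi> a + D_law \<iota> B \<mu> \<beta> (snd F) \<psi> a = 0)"
proof
  assume eq: "D_gen \<iota> B \<mu> \<beta> F \<psi> = - Q_gen \<iota> B \<mu> \<beta> F \<phi>"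
  show "\<forall>a. graded_assignment (gcomp B) a \<longrightarrow> Q_law \<iota> B \<mu> \<beta> (snd F) \<phi> a + D_law \<iota> B \<mu> \<beta> (snd F) \<psi> a = 0"
  proof (intro allI impI)
    fix a assume a: "graded_assignment (gcomp B) a"
    let ?a = "arg_assignment B (fst F) (map a (fst F))"
    have a_eq: "?a x = a x" if "x \<in> set (fst F)" for x
    proof -
      have "a x \<in> gcomp B (snd x)" using a by (cases x) (simp add: graded_assignment_def)
      then show ?thesis
        using that by (simp add: arg_assignment_def map_of_zip_map gproj_homogeneous)
    qed
    have "D_law \<iota> B \<mu> \<beta> (snd F) \<psi> ?a = D_law \<iota> B \<mu> \<beta> (snd F) \<psi> a"
      unfolding D_law_def tlaw_eval_def
      by (rule fun_cong[OF law_eval_cong[OF F \<beta>]]) (simp add: a_eq)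
    moreover have "Q_law \<iota> B \<mu> \<beta> (snd F) \<phi> ?a = Q_law \<iota> B \<mu> \<beta> (snd F) \<phi> a"
      unfolding Q_law_def tlaw_eval_def
      by (rule fun_cong[OF law_eval_cong[OF F \<beta>]]) (simp add: a_eq)
    ultimately show "Q_law \<iota> B \<mu> \<beta> (snd F) \<phi> a + D_law \<iota> B \<mu> \<beta> (snd F) \<psi> a = 0"
      using fun_cong[OF eq, of "map a (fst F)"] by (simp add: D_gen_def Q_gen_def hom_of_def)
  qed
next
  assume *: "\<forall>a. graded_assignment (gcomp B) a \<longrightarrow>
    Q_law \<iota> B \<mu> \<beta> (snd F) \<phi> a + D_law \<iota> B \<mu> \<beta> (snd F) \<psi> a = 0"
  then have "D_law \<iota> B \<mu> \<beta> (snd F) \<psi> (arg_assignment B (fst F) bs)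
      = - Q_law \<iota> B \<mu> \<beta> (snd F) \<phi> (arg_assignment B (fst F) bs)" for bs
    using arg_assignment_graded by (simp add: eq_neg_iff_add_eq_0 add.commute)
  then show "D_gen \<iota> B \<mu> \<beta> F \<psi> = - Q_gen \<iota> B \<mu> \<beta> F \<phi>"
    by (auto simp: D_gen_def Q_gen_def hom_of_def fun_eq_iff)
qed

text \<open>
  A lift is determined by its second-order term, and its reduction modulo \<open>t\<^sup>2\<close> is automatic.
\<close>

lemma second_order_lift_iff:
  assumes \<phi>: "\<phi> \<in> cochains B 2" "d_Hoch \<mu> \<phi> = 0"
  shows "(\<exists>M. second_order_lift \<iota> B \<mu> I \<phi> M) \<longleftrightarrow>
    (\<exists>\<psi>\<in>cochains B 2. d_Hoch \<mu> \<psi> = - Q_ass \<phi> \<and>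
      satisfies (\<lambda>c. tscale B (\<iota> c)) (tcomp B 3) (tconst (gunit B))
        (tlaw 3 [\<mu>, binary \<phi>, binary \<psi>]) I)" (is "?l \<longleftrightarrow> ?r")
proof
  assume ?l
  then show ?r
    unfolding second_order_lift_def using second_order_mult_iff[OF \<phi>] by blast
next
  have cut: "tcut 2 (tlaw 3 [\<mu>, binary \<phi>, m] a b) = tlaw 2 [\<mu>, binary \<phi>] (tcut 2 a) (tcut 2 b)" for m a b
    by (rule tspace_2_eqI)
      (simp_all add: tlaw_in_tspace tlaw_2_coeffs tlaw_3_coeffs tcut_def, simp add: tspace_def)
  assume ?r
  then show ?l
    unfolding second_order_lift_def using second_order_mult_iff[OF \<phi>] cut by blast
qed

text \<open>
  By the reductions to generators and to constant arguments, only the three coefficients of a generator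
  at arguments in \<open>B\<close> matter.  The coefficient of \<open>1\<close> vanishes because \<open>B\<close> satisfies \<open>I\<close>, the
  coefficient of \<open>t\<close> because \<open>\<phi>\<close> lies in \<open>Z\<^sup>2\<close>, and the coefficient of \<open>t\<^sup>2\<close> is \<open>Q(\<phi>) + D(\<psi>)\<close>.
\<close>

lemma satisfies_iff_generators:
  assumes gens: "generating_system I gens" and \<beta>: "bracketing \<beta>"
    and sat: "satisfies (\<lambda>c. gscale B (\<iota> c)) (gcomp B) (gunit B) \<mu> I"
    and \<phi>: "\<phi> \<in> Z2 \<iota> B \<mu> \<beta> I" and \<psi>: "\<psi> \<in> cochains B 2" and obs: "d_Hoch \<mu> \<psi> = - Q_ass \<phi>"
  shows "satisfies (\<lambda>c. tscale B (\<iota> c)) (tcomp B 3) (tconst (gunit B))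
      (tlaw 3 [\<mu>, binary \<phi>, binary \<psi>]) I \<longleftrightarrow>
    (\<forall>j<length gens. D_gen \<iota> B \<mu> \<beta> (gens ! j) \<psi> = - Q_gen \<iota> B \<mu> \<beta> (gens ! j) \<phi>)"
proof -
  have \<phi>C: "\<phi> \<in> cochains B 2" "d_Hoch \<mu> \<phi> = 0"
    and D0: "\<And>f a. f \<in> I \<Longrightarrow> graded_assignment (gcomp B) a \<Longrightarrow> D_law \<iota> B \<mu> \<beta> f \<phi> a = 0"
    using \<phi> by (auto simp: Z2_def)
  note bil = bilinear_mult cochains2D(2)[OF \<phi>C(1)] cochains2D(2)[OF \<psi>]
  interpret base: unital_graded_algebra "\<lambda>c. gscale B (\<iota> c)" UNIV "gcomp B" "gunit B" \<mu>
    by (rule base_algebra)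
  interpret ext: unital_graded_algebra "\<lambda>c. tscale B (\<iota> c)" "tspace 3" "tcomp B 3"
    "tconst (gunit B)" "tlaw 3 [\<mu>, binary \<phi>, binary \<psi>]"
    using second_order_mult_iff[OF \<phi>C \<psi>] obs bil by (intro truncated_algebra) auto
  have I: "I = graded_T_ideal hull (snd ` set gens)"
    and F: "\<And>F. F \<in> set gens \<Longrightarrow> multilinear_generator F"
    using gens by (auto simp: generating_system_def)
  have FI: "snd F \<in> I" if "F \<in> set gens" for F
    unfolding I using that by (intro hull_inc) auto
  have *: "(\<forall>b. graded_assignment (tcomp B 3) b \<longrightarrow> ext.ev (snd F) b = 0) \<longleftrightarrow>
      D_gen \<iota> B \<mu> \<beta> F \<psi> = - Q_gen \<iota> B \<mu> \<beta> F \<phi>" if FG: "F \<in> set gens" for F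
  proof -
    have ev: "ext.ev (snd F) b = law_eval (\<lambda>c. tscale B (\<iota> c)) (tconst (gunit B))
        (tlaw 3 [\<mu>, binary \<phi>, binary \<psi>]) \<beta> (snd F) b" if "\<And>x. b x \<in> tspace 3" for b
      using ext.law_eval_eq_assoc_eval[OF \<beta> that] by simp
    let ?X = "tlaw_eval \<iota> B 3 [\<mu>, binary \<phi>, binary \<psi>] \<beta> (snd F)"
    have "?X a = 0 \<longleftrightarrow> Q_law \<iota> B \<mu> \<beta> (snd F) \<phi> a + D_law \<iota> B \<mu> \<beta> (snd F) \<psi> a = 0"
      if a: "graded_assignment (gcomp B) a" for a
    proof
      assume "?X a = 0"
      then show "Q_law \<iota> B \<mu> \<beta> (snd F) \<phi> a + D_law \<iota> B \<mu> \<beta> (snd F) \<psi> a = 0"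
        using tlaw_eval_coeffs(3)[of \<phi> \<psi> \<beta> "snd F" a] by simp
    next
      assume "Q_law \<iota> B \<mu> \<beta> (snd F) \<phi> a + D_law \<iota> B \<mu> \<beta> (snd F) \<psi> a = 0"
      moreover have "law_eval (\<lambda>c. gscale B (\<iota> c)) (gunit B) \<mu> \<beta> (snd F) a = 0"
        using sat FI[OF FG] a base.law_eval_eq_assoc_eval[OF \<beta>, of a] by (simp add: satisfies_def)
      ultimately show "?X a = 0"
        using D0[OF FI[OF FG] a]
        by (intro tspace_3_eqI) (simp_all add: tlaw_eval_coeffs, simp add: tspace_def)
    qed
    moreover have "(\<forall>b. graded_assignment (tcomp B 3) b \<longrightarrow> ext.ev (snd F) b = 0) \<longleftrightarrow>
      (\<forall>a. graded_assignment (gcomp B) a \<longrightarrow> ?X a = 0)"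
    proof
      assume L: "\<forall>b. graded_assignment (tcomp B 3) b \<longrightarrow> ext.ev (snd F) b = 0"
      show "\<forall>a. graded_assignment (gcomp B) a \<longrightarrow> ?X a = 0"
      proof (intro allI impI)
        fix a assume "graded_assignment (gcomp B) a"
        then have "graded_assignment (tcomp B 3) (\<lambda>x. tconst (a x))"
          by (auto simp: graded_assignment_def tcomp_3_iff tconst_tspace tconst_coeffs gcomp_closed)
        then show "?X a = 0" using L ev[of "\<lambda>x. tconst (a x)"] by (simp add: tlaw_eval_def tconst_tspace)
      qed
    next
      assume "\<forall>a. graded_assignment (gcomp B) a \<longrightarrow> ?X a = 0"
      then show "\<forall>b. graded_assignment (tcomp B 3) b \<longrightarrow> ext.ev (snd F) b = 0"
        using identity_on_constants[OF F[OF FG] \<beta> bil] ev ext.assignment_in by simp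
    qed
    ultimately show ?thesis using D_gen_eq_iff[OF F[OF FG] \<beta>] by blast
  qed
  have "satisfies (\<lambda>c. tscale B (\<iota> c)) (tcomp B 3) (tconst (gunit B))
      (tlaw 3 [\<mu>, binary \<phi>, binary \<psi>]) I \<longleftrightarrow>
      (\<forall>F\<in>set gens. \<forall>b. graded_assignment (tcomp B 3) b \<longrightarrow> ext.ev (snd F) b = 0)"
    unfolding I ext.satisfies_hull_iff by (auto simp: satisfies_def)
  also have "\<dots> \<longleftrightarrow> (\<forall>j<length gens. D_gen \<iota> B \<mu> \<beta> (gens ! j) \<psi> = - Q_gen \<iota> B \<mu> \<beta> (gens ! j) \<phi>)"
    by (simp add: * all_set_conv_all_nth)
  finally show ?thesis .
qed

lemma lift_iff_obstruction_equations:
  assumes "generating_system I gens" "bracketing \<beta>"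
    and "satisfies (\<lambda>c. gscale B (\<iota> c)) (gcomp B) (gunit B) \<mu> I" and "\<phi> \<in> Z2 \<iota> B \<mu> \<beta> I"
  shows "(\<exists>M. second_order_lift \<iota> B \<mu> I \<phi> M) \<longleftrightarrow>
    (\<exists>\<psi>\<in>cochains B 2. d_Hoch \<mu> \<psi> = - Q_ass \<phi> \<and>
       (\<forall>j<length gens. D_gen \<iota> B \<mu> \<beta> (gens ! j) \<psi> = - Q_gen \<iota> B \<mu> \<beta> (gens ! j) \<phi>))"
proof -
  have "\<phi> \<in> cochains B 2" "d_Hoch \<mu> \<phi> = 0" using assms(4) by (auto simp: Z2_def)
  then show ?thesis
    using second_order_lift_iff satisfies_iff_generators[OF assms] by blast
qed

end

section \<open>The obstruction class\<close>

context graded_algebra_over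
begin

lemma multilinear_maps_closed:
  "0 \<in> multilinear_maps B n"
  "h \<in> multilinear_maps B n \<Longrightarrow> h' \<in> multilinear_maps B n \<Longrightarrow> h + h' \<in> multilinear_maps B n"
  "h \<in> multilinear_maps B n \<Longrightarrow> (\<lambda>xs. gscale B c (h xs)) \<in> multilinear_maps B n"
  by (simp_all add: multilinear_maps_def linear_iff_additive scale_right_distrib add_ac
      scale_left_commute)

lemma cochains_closed:
  "0 \<in> cochains B n"
  "h \<in> cochains B n \<Longrightarrow> h' \<in> cochains B n \<Longrightarrow> h + h' \<in> cochains B n"
  "h \<in> cochains B n \<Longrightarrow> (\<lambda>xs. gscale B c (h xs)) \<in> cochains B n"
  by (auto simp: cochains_def multilinear_maps_closed gcomp_closed)

text \<open>
  The arguments are freed from the spanning set one at a time, from left to right; in the induction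
  the first \<open>k\<close> arguments are arbitrary.
\<close>

lemma multilinear_map_eq_0_if_basis:
  assumes h: "h \<in> multilinear_maps B n" and S: "span S = UNIV"
    and zero: "\<And>bs. length bs = n \<Longrightarrow> set bs \<subseteq> S \<Longrightarrow> h bs = 0"
  shows "h = 0"
proof -
  have drop: "h xs = 0" if "k \<le> n" "length xs = n" "set (drop k xs) \<subseteq> S" for k xs
    using that
  proof (induction k arbitrary: xs)
    case 0
    then show ?case using zero by simp
  next
    case (Suc k)
    then have k: "k < length xs" by simp
    have lin: "Vector_Spaces.linear (gscale B) (gscale B) (\<lambda>x. h (xs[k := x]))"
      using h Suc.prems by (simp add: multilinear_maps_def)
    then have add: "h (xs[k := x + y]) = h (xs[k := x]) + h (xs[k := y])"
      and scl: "h (xs[k := gscale B c x]) = gscale B c (h (xs[k := x]))" for x y c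
      by (simp_all add: linear_iff_additive)
    have "subspace {x. h (xs[k := x]) = 0}"
      using add scl scl[of 0 0] by (auto simp: subspace_def)
    moreover have "S \<subseteq> {x. h (xs[k := x]) = 0}"
    proof
      fix e assume "e \<in> S"
      moreover have "drop k (xs[k := e]) = e # drop (Suc k) xs"
        using k by (simp add: drop_update_swap Cons_nth_drop_Suc[symmetric])
      ultimately show "e \<in> {x. h (xs[k := x]) = 0}"
        using Suc.prems Suc.IH[of "xs[k := e]"] by simp
    qed
    ultimately have "span S \<subseteq> {x. h (xs[k := x]) = 0}" by (rule span_minimal[rotated])
    then have "h (xs[k := xs ! k]) = 0" using S by blast
    then show ?case by simp
  qed
  show ?thesis
  proof
    fix xs
    show "h xs = 0 xs"
    proof (cases "length xs = n")
      case True
      then show ?thesis using drop[of n xs] by simp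
    next
      case False
      then show ?thesis using h by (simp add: multilinear_maps_def)
    qed
  qed
qed

lemma arg_assignment_update:
  assumes "distinct vs" "length bs = length vs" "i < length vs"
  shows "arg_assignment B vs (bs[i := y]) = (arg_assignment B vs bs)(vs ! i := gproj B (snd (vs ! i)) y)"
proof
  fix x
  show "arg_assignment B vs (bs[i := y]) x
      = ((arg_assignment B vs bs)(vs ! i := gproj B (snd (vs ! i)) y)) x"
  proof (cases "x \<in> set vs")
    case True
    then obtain j where j: "j < length vs" "x = vs ! j" by (metis in_set_conv_nth)
    have "map_of (zip vs cs) (vs ! j) = Some (cs ! j)" if "length cs = length vs" for cs :: "'v list"
      using j(1) that by (intro map_of_zip_nth[OF that[symmetric] assms(1)]) simp
    then have lookup: "arg_assignment B vs cs x = gproj B (snd x) (cs ! j)"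
      if "length cs = length vs" for cs
      using that by (simp only: arg_assignment_def j(2) option.case)
    show ?thesis
    proof (cases "i = j")
      case True
      then show ?thesis using assms(2) j(1) lookup[of "bs[i := y]"] by (simp add: j(2))
    next
      case False
      then have "vs ! i \<noteq> x" using assms(1,3) j by (simp add: nth_eq_iff_index_eq)
      then show ?thesis using False assms(2) by (auto simp: lookup)
    qed
  next
    case False
    then have "map_of (zip vs cs) x = None" for cs :: "'v list"
      by (auto simp: map_of_eq_None_iff dest: set_zip_leftD)
    then show ?thesis using False assms(3) by (auto simp: arg_assignment_def)
  qed
qed

lemma hom_of_tlaw_eval_multilinear:
  assumes F: "multilinear_generator F" and \<beta>: "bracketing \<beta>"
    and bil: "\<And>m. m \<in> set ms \<Longrightarrow> bilinear_law B m"
  shows "hom_of B (fst F) (\<lambda>a. tlaw_eval \<iota> B n ms \<beta> (snd F) a l) \<in> multilinear_maps B (length (fst F))"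
proof -
  let ?E = "\<lambda>b. law_eval (\<lambda>c. tscale B (\<iota> c)) (tconst (gunit B)) (tlaw n ms) \<beta> (snd F) b"
  have "distinct (fst F)" using F by (simp add: multilinear_generator_def)
  have scale_add: "tscale B c (x + y) = tscale B c x + tscale B c y" for c x y
    by (simp add: tscale_def fun_eq_iff scale_right_distrib)
  have add: "?E (b(x := y + z)) = ?E (b(x := y)) + ?E (b(x := z))" if "x \<in> set (fst F)" for b x y z
    by (rule law_eval_add[OF F \<beta> that]) (rule tlaw_add[OF bil] scale_add; assumption)+
  have scl: "?E (b(x := tscale B c y)) = tscale B c (?E (b(x := y)))" if "x \<in> set (fst F)" for b x c y
    by (rule law_eval_operator[OF F \<beta> that])
      (simp_all add: tlaw_tscale[OF bil] scale_add, simp_all add: tscale_def scale_left_commute scale_right_distrib fun_eq_iff)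
  have upd: "(\<lambda>z. tconst ((a(x := y)) z)) = (\<lambda>z. tconst (a z))(x := tconst y)"
    for a and x :: "nat \<times> 'g" and y :: 'v by auto
  have tadd: "tconst (y + z) = tconst y + tconst z" for y z :: 'v by (auto simp: tconst_def)
  have tscl: "tconst (gscale B c y) = tscale B c (tconst y)" for c y
    by (auto simp: tconst_def tscale_def)
  have "Vector_Spaces.linear (gscale B) (gscale B)
      (\<lambda>y. hom_of B (fst F) (\<lambda>a. tlaw_eval \<iota> B n ms \<beta> (snd F) a l) (xs[i := y]))"
    if "length xs = length (fst F)" "i < length (fst F)" for xs i
    using that \<open>distinct (fst F)\<close>
    by (simp add: linear_iff_additive hom_of_def arg_assignment_update tlaw_eval_def upd gproj_add
        gproj_scale tadd tscl add scl del: fun_upd_apply) (simp add: tscale_def)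
  then show ?thesis by (auto simp: multilinear_maps_def hom_of_def)
qed

lemma D_gen_multilinear:
  assumes "multilinear_generator F" "bracketing \<beta>" "\<psi> \<in> cochains B 2"
  shows "D_gen \<iota> B \<mu> \<beta> F \<psi> \<in> multilinear_maps B (length (fst F))"
  unfolding D_gen_def D_law_def
  by (rule hom_of_tlaw_eval_multilinear)
    (use assms in \<open>auto simp: bilinear_mult cochains2D\<close>)

lemma Q_gen_multilinear:
  assumes "multilinear_generator F" "bracketing \<beta>" "\<phi> \<in> cochains B 2"
  shows "Q_gen \<iota> B \<mu> \<beta> F \<phi> \<in> multilinear_maps B (length (fst F))"
  unfolding Q_gen_def Q_law_def
  by (rule hom_of_tlaw_eval_multilinear)
    (use assms in \<open>auto simp: bilinear_mult cochains2D\<close>)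

text \<open>
  The coefficient of \<open>t\<close> collects the terms in which the operation \<open>m\<close> is used exactly once.
\<close>

lemma bracketed_eval_differential_linear:
  fixes a :: "'x \<Rightarrow> 'v" and t :: "'x bracketed"
  defines "Z \<equiv> \<lambda>m. bracketed_eval (tlaw 2 [\<mu>, m]) (\<lambda>x. tconst (a x)) t"
  shows "Z (\<lambda>x y. m x y + m' x y) (Suc 0) = Z m (Suc 0) + Z m' (Suc 0)"
    and "Z (\<lambda>x y. gscale B c (m x y)) (Suc 0) = gscale B c (Z m (Suc 0))"
proof -
  note mu = bilinear_law_simps[OF bilinear_mult]
  have 0: "bracketed_eval (tlaw 2 [\<mu>, m]) (\<lambda>x. tconst (a x)) t 0 = bracketed_eval \<mu> a t"
    for m and t :: "'x bracketed"
    by (induction t) (simp_all add: tconst_coeffs tlaw_2_coeffs)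
  show "Z (\<lambda>x y. m x y + m' x y) (Suc 0) = Z m (Suc 0) + Z m' (Suc 0)"
    unfolding Z_def
    by (induction t) (simp_all add: tconst_coeffs tlaw_2_coeffs 0 mu add_ac)
  show "Z (\<lambda>x y. gscale B c (m x y)) (Suc 0) = gscale B c (Z m (Suc 0))"
    unfolding Z_def
    by (induction t) (simp_all add: tconst_coeffs tlaw_2_coeffs 0 mu scale_right_distrib)
qed

lemma D_law_linear:
  "D_law \<iota> B \<mu> \<beta> f (\<psi> + \<psi>') a = D_law \<iota> B \<mu> \<beta> f \<psi> a + D_law \<iota> B \<mu> \<beta> f \<psi>' a"
  "D_law \<iota> B \<mu> \<beta> f (\<lambda>xs. gscale B c (\<psi> xs)) a = gscale B c (D_law \<iota> B \<mu> \<beta> f \<psi> a)"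
proof -
  note defs = D_law_def tlaw_eval_def law_eval_def sum_fun_eval tscale_def One_nat_def
  show "D_law \<iota> B \<mu> \<beta> f (\<psi> + \<psi>') a = D_law \<iota> B \<mu> \<beta> f \<psi> a + D_law \<iota> B \<mu> \<beta> f \<psi>' a"
    unfolding defs sum.distrib[symmetric] plus_fun_apply
    by (intro sum.cong)
      (simp_all add: bracketed_eval_differential_linear tconst_coeffs scale_right_distrib)
  show "D_law \<iota> B \<mu> \<beta> f (\<lambda>xs. gscale B c (\<psi> xs)) a = gscale B c (D_law \<iota> B \<mu> \<beta> f \<psi> a)"
    unfolding defs scale_sum_right
    by (intro sum.cong)
      (simp_all add: bracketed_eval_differential_linear tconst_coeffs scale_left_commute)
qed

lemma L_op_linear:
  "L_op \<iota> B \<mu> \<beta> gens (\<psi> + \<psi>') = L_op \<iota> B \<mu> \<beta> gens \<psi> + L_op \<iota> B \<mu> \<beta> gens \<psi>'"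
  "L_op \<iota> B \<mu> \<beta> gens (\<lambda>xs. gscale B c (\<psi> xs)) = target_scale B c (L_op \<iota> B \<mu> \<beta> gens \<psi>)"
proof -
  note mu = bilinear_law_simps[OF bilinear_mult]
  have "d_Hoch \<mu> (\<psi> + \<psi>') = d_Hoch \<mu> \<psi> + d_Hoch \<mu> \<psi>'"
    by (auto simp: d_Hoch_def mu algebra_simps fun_eq_iff split: list.split)
  then show "L_op \<iota> B \<mu> \<beta> gens (\<psi> + \<psi>') = L_op \<iota> B \<mu> \<beta> gens \<psi> + L_op \<iota> B \<mu> \<beta> gens \<psi>'"
    by (auto simp: L_op_def D_gen_def hom_of_def D_law_linear plus_prod_def fun_eq_iff)
  have "d_Hoch \<mu> (\<lambda>xs. gscale B c (\<psi> xs)) = (\<lambda>xs. gscale B c (d_Hoch \<mu> \<psi> xs))"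
    by (auto simp: d_Hoch_def mu scale_right_distrib scale_right_diff_distrib fun_eq_iff
        split: list.split)
  then show "L_op \<iota> B \<mu> \<beta> gens (\<lambda>xs. gscale B c (\<psi> xs)) = target_scale B c (L_op \<iota> B \<mu> \<beta> gens \<psi>)"
    by (auto simp: L_op_def target_scale_def D_gen_def hom_of_def D_law_linear fun_eq_iff)
qed

sublocale target: vector_space "target_scale B"
  by unfold_locales
    (simp_all add: target_scale_def prod_eq_iff fun_eq_iff scale_right_distrib scale_left_distrib)

lemma subspace_target: "target.subspace (target_space B gens)"
proof (rule target.subspaceI)
  show "0 \<in> target_space B gens"
    by (auto simp: target_space_def zero_prod_def cochains_closed multilinear_maps_closed)
  show "x + y \<in> target_space B gens" if "x \<in> target_space B gens" "y \<in> target_space B gens" for x y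
    using that by (auto simp: target_space_def cochains_closed multilinear_maps_closed)
  show "target_scale B c x \<in> target_space B gens" if "x \<in> target_space B gens" for c x
    using that
    by (auto simp: target_space_def target_scale_def cochains_closed multilinear_maps_closed fun_eq_iff)
qed

lemma subspace_L_image: "target.subspace (L_image \<iota> B \<mu> \<beta> gens)"
proof (rule target.subspaceI)
  have "L_op \<iota> B \<mu> \<beta> gens 0 + L_op \<iota> B \<mu> \<beta> gens 0 = L_op \<iota> B \<mu> \<beta> gens 0"
    using L_op_linear(1)[of \<beta> gens 0 0] by simp
  then have "L_op \<iota> B \<mu> \<beta> gens 0 = 0" by simp
  then show "0 \<in> L_image \<iota> B \<mu> \<beta> gens"
    unfolding L_image_def using cochains_closed(1) by (metis imageI)
  show "x + y \<in> L_image \<iota> B \<mu> \<beta> gens"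
    if "x \<in> L_image \<iota> B \<mu> \<beta> gens" "y \<in> L_image \<iota> B \<mu> \<beta> gens" for x y
    using that unfolding L_image_def by (auto simp: cochains_closed simp flip: L_op_linear(1))
  show "target_scale B c x \<in> L_image \<iota> B \<mu> \<beta> gens" if "x \<in> L_image \<iota> B \<mu> \<beta> gens" for c x
    using that unfolding L_image_def by (auto simp: cochains_closed simp flip: L_op_linear(2))
qed

lemma L_image_subset_target:
  assumes "\<And>F. F \<in> set gens \<Longrightarrow> multilinear_generator F" "bracketing \<beta>"
  shows "L_image \<iota> B \<mu> \<beta> gens \<subseteq> target_space B gens"
proof -
  have "multilinear_generator (gens ! j)" if "j < length gens" for j
    using assms(1) that by simp
  then show ?thesis
    using assms(2)
    by (auto simp: L_image_def L_op_def target_space_def d_Hoch_cochain D_gen_multilinear)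
qed

lemma obstruction_in_coker:
  assumes "\<And>F. F \<in> set gens \<Longrightarrow> multilinear_generator F" "bracketing \<beta>" "\<phi> \<in> cochains B 2"
  shows "obstruction \<iota> B \<mu> \<beta> gens \<phi> \<in> coker \<iota> B \<mu> \<beta> gens"
  unfolding obstruction_def coker_def using assms
  by (intro imageI) (auto simp: target_space_def Q_ass_cochain Q_gen_multilinear)

text \<open>
  The class vanishes when its representative lies in the image of the linear operator.  The image is a
  subspace, so it may be tested on the negative of the representative, which yields the equations with
  the sign that they have for a lift.
\<close>

lemma obstruction_zero_iff:
  "obstruction \<iota> B \<mu> \<beta> gens \<phi> = coker_zero \<iota> B \<mu> \<beta> gens \<longleftrightarrow>
    (\<exists>\<psi>\<in>cochains B 2. d_Hoch \<mu> \<psi> = - Q_ass \<phi> \<and>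
       (\<forall>j<length gens. D_gen \<iota> B \<mu> \<beta> (gens ! j) \<psi> = - Q_gen \<iota> B \<mu> \<beta> (gens ! j) \<phi>))"
proof -
  let ?q = "(Q_ass \<phi>, \<lambda>j. if j < length gens then Q_gen \<iota> B \<mu> \<beta> (gens ! j) \<phi> else 0)"
  have "obstruction \<iota> B \<mu> \<beta> gens \<phi> = coker_zero \<iota> B \<mu> \<beta> gens \<longleftrightarrow> ?q \<in> L_image \<iota> B \<mu> \<beta> gens"
    unfolding obstruction_def coker_zero_def target.coset_eq_iff[OF subspace_L_image] by simp
  also have "\<dots> \<longleftrightarrow> - ?q \<in> L_image \<iota> B \<mu> \<beta> gens"
    using target.subspace_neg[OF subspace_L_image, of ?q] target.subspace_neg[OF subspace_L_image, of "- ?q"]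
    by auto
  also have "\<dots> \<longleftrightarrow> (\<exists>\<psi>\<in>cochains B 2. L_op \<iota> B \<mu> \<beta> gens \<psi> = - ?q)"
    unfolding L_image_def by (auto simp: image_iff eq_commute)
  also have "\<dots> \<longleftrightarrow> (\<exists>\<psi>\<in>cochains B 2. d_Hoch \<mu> \<psi> = - Q_ass \<phi> \<and>
       (\<forall>j<length gens. D_gen \<iota> B \<mu> \<beta> (gens ! j) \<psi> = - Q_gen \<iota> B \<mu> \<beta> (gens ! j) \<phi>))"
    by (intro bex_cong refl) (auto simp: L_op_def uminus_prod_def fun_eq_iff)
  finally show ?thesis .
qed

text \<open>
  A multilinear map is determined by the coordinates of its values on tuples of basis vectors, and
  there are finitely many of these.
\<close>

lemma target_space_finite_dimensional: "\<exists>S. finite S \<and> target_space B gens \<subseteq> target.span S"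
proof -
  obtain S where S: "finite S" "span S = UNIV" by (rule finite_dimensional)
  obtain E where E: "E \<subseteq> S" "independent E" "S \<subseteq> span E"
    using maximal_independent_subset by blast
  have spanE: "span E = UNIV" using span_minimal[OF E(3) subspace_span] S(2) by auto
  have "finite E" using E(1) S(1) finite_subset by blast
  define Tup where "Tup n = {bs. set bs \<subseteq> E \<and> length bs = n}" for n
  have finT: "finite (Tup n)" for n
    unfolding Tup_def using \<open>finite E\<close> by (rule finite_lists_length_eq)
  have coord0: "v = 0" if "\<And>e. e \<in> E \<Longrightarrow> representation E v e = 0" for v
  proof -
    have none: "representation E v e = 0" for e
      using that representation_ne_zero by blast
    have "v = (\<Sum>e | representation E v e \<noteq> 0. gscale B (representation E v e) e)"
      using E(2) spanE by (intro sum_nonzero_representation_eq[symmetric]) auto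
    also have "\<dots> = 0" using none by simp
    finally show ?thesis .
  qed
  have coord_lin: "representation E (x + y) e = representation E x e + representation E y e"
    "representation E (gscale B c x) e = c * representation E x e" for x y c e
    using E(2) spanE by (simp_all add: representation_add representation_scale)
  define \<Lambda> :: "('v target \<Rightarrow> 'k) set" where
    "\<Lambda> = (\<Union>e\<in>E. (\<lambda>bs q. representation E (fst q bs) e) ` Tup 3) \<union>
      (\<Union>j<length gens. \<Union>e\<in>E. (\<lambda>bs q. representation E (snd q j bs) e) ` Tup (length (fst (gens ! j))))"
  show ?thesis
  proof (rule target.finite_span_if_separated[of \<Lambda>])
    show "finite \<Lambda>" using finT \<open>finite E\<close> by (simp add: \<Lambda>_def)
    show "target.subspace (target_space B gens)" by (rule subspace_target)
    show "l (x + y) = l x + l y" "l (target_scale B c x) = c * l x" if "l \<in> \<Lambda>" for l x y c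
      using that by (auto simp: \<Lambda>_def coord_lin target_scale_def)
    fix q assume q: "q \<in> target_space B gens" and zero: "\<And>l. l \<in> \<Lambda> \<Longrightarrow> l q = 0"
    have "fst q = 0"
    proof (rule multilinear_map_eq_0_if_basis[OF _ spanE])
      show "fst q \<in> multilinear_maps B 3"
        using q by (auto simp: target_space_def cochains_def)
      fix bs assume "length bs = 3" "set bs \<subseteq> E"
      then have "(\<lambda>q. representation E (fst q bs) e) \<in> \<Lambda>" if "e \<in> E" for e
        using that by (auto simp: \<Lambda>_def Tup_def)
      then show "fst q bs = 0" using zero by (intro coord0) blast
    qed
    moreover have "snd q j = 0" for j
    proof (cases "j < length gens")
      case True
      show ?thesis
      proof (rule multilinear_map_eq_0_if_basis[OF _ spanE])
        show "snd q j \<in> multilinear_maps B (length (fst (gens ! j)))"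
          using q True by (auto simp: target_space_def)
        fix bs assume "length bs = length (fst (gens ! j))" "set bs \<subseteq> E"
        then have "(\<lambda>q. representation E (snd q j bs) e) \<in> \<Lambda>" if "e \<in> E" for e
          using that True unfolding \<Lambda>_def Tup_def
          by (intro UnI2 UN_I[of j] UN_I[of e] image_eqI[of _ _ bs]) auto
        then show "snd q j bs = 0" using zero by (intro coord0) blast
      qed
    next
      case False
      then show ?thesis using q by (auto simp: target_space_def)
    qed
    ultimately show "q = 0" by (simp add: prod_eq_iff fun_eq_iff)
  qed
qed

text \<open>
  The zero polynomial, as a generator in no variables, may be adjoined to every generating system.
\<close>

lemma generating_system_append_zero:
  assumes "generating_system I gens"
  shows "generating_system I (gens @ [([], 0)])"
proof -
  have "0 \<in> graded_T_ideal hull (snd ` set gens)"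
    by (auto simp: hull_def graded_T_ideal_def)
  then have "graded_T_ideal hull (insert 0 (snd ` set gens)) = graded_T_ideal hull (snd ` set gens)"
    by (rule hull_redundant)
  then show ?thesis
    using assms by (auto simp: generating_system_def multilinear_generator_def)
qed

text \<open>
  The new summand of the target is \<open>Hom(B\<^sup>\<otimes>\<^sup>0, B)\<close>, a copy of \<open>B \<noteq> 0\<close>, while the image of the operator stays
  the same because the differential of the zero polynomial is zero.  So the dimension of the cokernel
  grows.
\<close>

lemma coker_depends_on_generators:
  assumes gens: "\<And>F. F \<in> set gens \<Longrightarrow> multilinear_generator F" and \<beta>: "bracketing \<beta>"
  shows "\<not> coker_isomorphic \<iota> B \<mu> \<beta> gens (gens @ [([], 0)])"
proof
  let ?N = "length gens" and ?gens' = "gens @ [([], 0)]"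
  let ?L = "L_image \<iota> B \<mu> \<beta> gens" and ?T = "target_space B gens" and ?T' = "target_space B ?gens'"
  have "D_gen \<iota> B \<mu> \<beta> ([], 0) \<psi> = 0" for \<psi>
    by (auto simp: D_gen_def hom_of_def D_law_def tlaw_eval_def law_eval_def)
  then have "L_op \<iota> B \<mu> \<beta> ?gens' = L_op \<iota> B \<mu> \<beta> gens"
    by (auto simp: L_op_def nth_append fun_eq_iff less_Suc_eq)
  then have L': "L_image \<iota> B \<mu> \<beta> ?gens' = ?L" by (simp add: L_image_def)
  have "?T \<subseteq> ?T'"
    by (auto simp: target_space_def nth_append less_Suc_eq multilinear_maps_closed)
  moreover
  \<comment> \<open>The unit, placed in the new summand, is in the larger target only.\<close>
  define c where "c xs = (if xs = [] then gunit B else 0)" for xs :: "'v list"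
  have "c \<in> multilinear_maps B 0" by (simp add: c_def multilinear_maps_def)
  then have "(0, \<lambda>j. if j = ?N then c else 0) \<in> ?T'"
    by (auto simp: target_space_def nth_append less_Suc_eq multilinear_maps_closed cochains_closed)
  moreover have "(0, \<lambda>j. if j = ?N then c else 0) \<notin> ?T"
  proof
    assume "(0, \<lambda>j. if j = ?N then c else 0) \<in> ?T"
    then have "c = 0" by (auto simp: target_space_def)
    then have "c [] = 0" by simp
    then show False using unit_neq_0 by (simp add: c_def)
  qed
  ultimately have TT': "?T \<subset> ?T'" by blast
  obtain S where S: "finite S" "?T \<subseteq> target.span S" using target_space_finite_dimensional by blast
  assume "coker_isomorphic \<iota> B \<mu> \<beta> gens ?gens'"
  then obtain \<Phi> where \<Phi>: "bij_betw \<Phi> ((\<lambda>q. q +o ?L) ` ?T) ((\<lambda>q. q +o ?L) ` ?T')"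
    "\<And>X Y. X \<in> (\<lambda>q. q +o ?L) ` ?T \<Longrightarrow> Y \<in> (\<lambda>q. q +o ?L) ` ?T \<Longrightarrow> \<Phi> (X + Y) = \<Phi> X + \<Phi> Y"
    "\<And>c X. X \<in> (\<lambda>q. q +o ?L) ` ?T \<Longrightarrow>
      \<Phi> (target_scale B c ` X + ?L) = target_scale B c ` \<Phi> X + ?L"
    unfolding coker_isomorphic_def coker_def coker_scale_def L' by metis
  show False
    by (rule target.no_linear_surjection_onto_larger_quotient[OF subspace_L_image subspace_target
          subspace_target L_image_subset_target[OF gens \<beta>] TT' S
          bij_betw_imp_surj_on[OF \<Phi>(1)] \<Phi>(2,3)])
qed

end

section \<open>Transport along isomorphisms of first-order deformations\<close>

context graded_algebra_over
begin

text \<open>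
  The map \<open>1 + t \<theta>\<close> is an isomorphism from \<open>\<mu> + t \<phi>\<close> to \<open>\<mu> + t \<phi>'\<close>; the last clause is the coefficient of
  \<open>t\<close> in the homomorphism property, solved for \<open>\<theta> (\<mu> x y)\<close>.
\<close>

definition infinitesimal_iso :: "('v list \<Rightarrow> 'v) \<Rightarrow> ('v list \<Rightarrow> 'v) \<Rightarrow> ('v \<Rightarrow> 'v) \<Rightarrow> bool" where
  "infinitesimal_iso \<phi> \<phi>' \<theta> \<longleftrightarrow>
     Vector_Spaces.linear (gscale B) (gscale B) \<theta> \<and> (\<forall>g. \<theta> ` gcomp B g \<subseteq> gcomp B g) \<and>
     \<theta> (gunit B) = 0 \<and>
     (\<forall>x y. \<theta> (\<mu> x y) = \<mu> (\<theta> x) y + \<mu> x (\<theta> y) + \<phi>' [x, y] - \<phi> [x, y])"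

text \<open>
  An isomorphism that commutes with \<open>t\<close> and is the identity modulo \<open>t\<close> has the form \<open>1 + t \<theta>\<close>, where \<open>\<theta>\<close>
  is the coefficient of \<open>t\<close> of its values on constants.
\<close>

lemma infinitesimal_iso_of_first_order_iso:
  assumes \<phi>: "\<phi> \<in> cochains B 2" "\<phi>' \<in> cochains B 2" and \<Theta>: "first_order_iso B \<mu> \<phi> \<phi>' \<Theta>"
  shows "infinitesimal_iso \<phi> \<phi>' (\<lambda>x. \<Theta> (tconst x) (Suc 0))"
proof -
  note bil = bilinear_law_simps[OF bilinear_mult] bilinear_law_simps[OF cochains2D(2)[OF \<phi>(1)]]
    bilinear_law_simps[OF cochains2D(2)[OF \<phi>(2)]]
  have add: "\<Theta> (a + b) = \<Theta> a + \<Theta> b" if "a \<in> tspace 2" "b \<in> tspace 2" for a b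
    using \<Theta> that by (auto simp: first_order_iso_def)
  have scl: "\<Theta> (tscale B c a) = tscale B c (\<Theta> a)" if "a \<in> tspace 2" for a c
    using \<Theta> that by (auto simp: first_order_iso_def)
  have shift: "\<Theta> (tshift 2 a) = tshift 2 (\<Theta> a)" if "a \<in> tspace 2" for a
    using \<Theta> that by (auto simp: first_order_iso_def)
  have hom: "\<Theta> (tlaw 2 [\<mu>, binary \<phi>] a b) = tlaw 2 [\<mu>, binary \<phi>'] (\<Theta> a) (\<Theta> b)"
    if "a \<in> tspace 2" "b \<in> tspace 2" for a b
    using \<Theta> that by (auto simp: first_order_iso_def)
  have zero: "\<Theta> a 0 = a 0" if "a \<in> tspace 2" for a
  proof -
    have "tcut 1 (\<Theta> a) = tcut 1 a" using \<Theta> that by (auto simp: first_order_iso_def)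
    from fun_cong[OF this, of 0] show ?thesis by (simp add: tcut_def)
  qed
  have const: "tconst x \<in> tspace 2" for x :: 'v by (simp add: tconst_tspace)
  have tadd: "tconst (x + y) = tconst x + tconst y" for x y :: 'v by (auto simp: tconst_def)
  have tscl: "tconst (gscale B c x) = tscale B c (tconst x)" for c x
    by (auto simp: tconst_def tscale_def)
  have one: "\<Theta> a (Suc 0) = \<Theta> (tconst (a 0)) (Suc 0) + a (Suc 0)" if a: "a \<in> tspace 2" for a
  proof -
    have "tshift 2 (tconst (a (Suc 0))) \<in> tspace 2" by (auto simp: tshift_def tspace_def)
    moreover have "a = tconst (a 0) + tshift 2 (tconst (a (Suc 0)))"
      using a by (intro tspace_2_eqI)
        (auto simp: tspace_def tshift_def tconst_def)
    ultimately have "\<Theta> a = \<Theta> (tconst (a 0)) + tshift 2 (\<Theta> (tconst (a (Suc 0))))"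
      using add const shift by metis
    then show ?thesis using zero[OF const] by (simp add: tshift_def tconst_coeffs)
  qed
  have "\<Theta> (tconst x) (Suc 0) \<in> gcomp B g" if "x \<in> gcomp B g" for x g
  proof -
    have "tconst x \<in> tcomp B 2 g"
      using that by (simp add: tcomp_2_iff const tconst_coeffs gcomp_closed)
    then have "\<Theta> (tconst x) \<in> tcomp B 2 g" using \<Theta> unfolding first_order_iso_def by blast
    then show ?thesis by (simp add: tcomp_2_iff)
  qed
  moreover have "\<Theta> (tconst (gunit B)) (Suc 0) = 0"
    using \<Theta> by (simp add: first_order_iso_def tconst_coeffs)
  moreover have "\<Theta> (tconst (\<mu> x y)) (Suc 0) = \<mu> (\<Theta> (tconst x) (Suc 0)) y + \<mu> x (\<Theta> (tconst y) (Suc 0))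
      + \<phi>' [x, y] - \<phi> [x, y]" for x y
    using one[OF tlaw_in_tspace, of "[\<mu>, binary \<phi>]" "tconst x" "tconst y"]
      fun_cong[OF hom[OF const const], of x y "Suc 0"] zero[OF const]
    by (simp add: tlaw_2_coeffs tconst_coeffs bil algebra_simps)
  moreover have "Vector_Spaces.linear (gscale B) (gscale B) (\<lambda>x. \<Theta> (tconst x) (Suc 0))"
    by (simp add: linear_iff_additive tadd tscl add const scl) (simp add: tscale_def)
  ultimately show ?thesis by (auto simp: infinitesimal_iso_def)
qed

text \<open>
  Modulo \<open>t\<^sup>2\<close> the inverse of \<open>1 + t \<theta>\<close> is \<open>1 - t \<theta>\<close>.
\<close>

lemma infinitesimal_iso_minus:
  assumes "infinitesimal_iso \<phi> \<phi>' \<theta>"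
  shows "infinitesimal_iso \<phi>' \<phi> (\<lambda>x. - \<theta> x)"
  using assms
  by (auto simp: infinitesimal_iso_def linear_iff_additive gcomp_closed image_subset_iff
      bilinear_law_simps[OF bilinear_mult])

text \<open>
  The formula \<open>1 + t \<theta>\<close> also defines an automorphism \<open>E\<close> of the graded space
  \<open>B \<otimes> k[t]/(t\<^sup>3)\<close>, with inverse \<open>1 - t \<theta> + t\<^sup>2 \<theta>\<^sup>2\<close>.  The law transported along \<open>E\<close> from a lift of
  \<open>\<mu> + t \<phi>\<close> is associative, unital, graded and satisfies \<open>I\<close>, and it is a lift of \<open>\<mu> + t \<phi>'\<close> because \<open>1 + t \<theta>\<close>
  is a homomorphism modulo \<open>t\<^sup>2\<close>.
\<close>

lemma transport_lift:
  assumes \<phi>: "\<phi> \<in> cochains B 2" "d_Hoch \<mu> \<phi> = 0" and \<phi>': "\<phi>' \<in> cochains B 2" "d_Hoch \<mu> \<phi>' = 0"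
    and iso: "infinitesimal_iso \<phi> \<phi>' \<theta>"
    and lift: "\<exists>M. second_order_lift \<iota> B \<mu> I \<phi> M"
  shows "\<exists>M. second_order_lift \<iota> B \<mu> I \<phi>' M"
proof -
  obtain \<psi> where \<psi>: "\<psi> \<in> cochains B 2" "d_Hoch \<mu> \<psi> = - Q_ass \<phi>"
    "satisfies (\<lambda>c. tscale B (\<iota> c)) (tcomp B 3) (tconst (gunit B)) (tlaw 3 [\<mu>, binary \<phi>, binary \<psi>]) I"
    using lift second_order_lift_iff[OF \<phi>] by blast
  note bil = bilinear_law_simps[OF bilinear_mult] bilinear_law_simps[OF cochains2D(2)[OF \<phi>(1)]]
    bilinear_law_simps[OF cochains2D(2)[OF \<phi>'(1)]] bilinear_law_simps[OF cochains2D(2)[OF \<psi>(1)]]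
  have \<theta>: "\<theta> (x + y) = \<theta> x + \<theta> y" "\<theta> (gscale B c x) = gscale B c (\<theta> x)"
    "\<theta> (gunit B) = 0" "\<theta> (\<mu> x y) = \<mu> (\<theta> x) y + \<mu> x (\<theta> y) + \<phi>' [x, y] - \<phi> [x, y]" for x y c
    using iso by (auto simp: infinitesimal_iso_def linear_iff_additive)
  have \<theta>_gr: "\<theta> x \<in> gcomp B g" if "x \<in> gcomp B g" for x g
    using iso that by (auto simp: infinitesimal_iso_def)
  have \<theta>0: "\<theta> 0 = 0" using \<theta>(1)[of 0 0] by simp
  have \<theta>_diff: "\<theta> (x - y) = \<theta> x - \<theta> y" for x y using \<theta>(1)[of "x - y" y] by simp
  \<comment> \<open>The coefficient of \<open>t\<^sup>2\<close> in \<open>E (M a b) = M' (E a) (E b)\<close>, solved for \<open>\<psi>'\<close> at constant \<open>a\<close> and \<open>b\<close>.\<close>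
  define \<psi>' where "\<psi>' xs = (case xs of [x, y] \<Rightarrow>
      \<psi> [x, y] + \<theta> (\<phi> [x, y]) - \<phi>' [\<theta> x, y] - \<phi>' [x, \<theta> y] - \<mu> (\<theta> x) (\<theta> y) | _ \<Rightarrow> 0)" for xs
  have \<psi>'_pair: "\<psi>' [x, y] = \<psi> [x, y] + \<theta> (\<phi> [x, y]) - \<phi>' [\<theta> x, y] - \<phi>' [x, \<theta> y] - \<mu> (\<theta> x) (\<theta> y)"
    for x y by (simp add: \<psi>'_def)
  note vanish = cochains2D(4,5)[OF \<phi>(1)] cochains2D(4,5)[OF \<phi>'(1)] cochains2D(4,5)[OF \<psi>(1)]
  note graded = cochains2D(3)[OF \<phi>(1)] cochains2D(3)[OF \<phi>'(1)] cochains2D(3)[OF \<psi>(1)]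
  have \<psi>': "\<psi>' \<in> cochains B 2"
    unfolding cochains2_iff
  proof (intro conjI allI impI ballI)
    show "\<psi>' xs = 0" if "length xs \<noteq> 2" for xs
      using that by (auto simp: \<psi>'_def split: list.split)
    show "bilinear_law B (binary \<psi>')"
      by (simp add: bilinear_law_def \<psi>'_pair bil \<theta>(1,2) scale_right_distrib scale_right_diff_distrib)
    show "\<psi>' [x, y] \<in> gcomp B (g + h)" if "x \<in> gcomp B g" "y \<in> gcomp B h" for g h x y
      unfolding \<psi>'_pair using that by (intro gcomp_closed mult_graded graded \<theta>_gr)
    show "\<psi>' [gunit B, x] = 0" "\<psi>' [x, gunit B] = 0" for x
      by (simp_all add: \<psi>'_pair vanish \<theta>(3) \<theta>0 bil)
  qed
  let ?M = "tlaw 3 [\<mu>, binary \<phi>, binary \<psi>]" and ?M' = "tlaw 3 [\<mu>, binary \<phi>', binary \<psi>']"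
    and ?u = "tconst (gunit B)"
  define E where "E a l = (if l = 0 then a 0 else if l < 3 then a l + \<theta> (a (l - 1)) else 0)"
    for a :: "nat \<Rightarrow> 'v" and l :: nat
  define E' where "E' a l = (if l = 0 then a 0 else if l = 1 then a 1 - \<theta> (a 0)
      else if l = 2 then a 2 - \<theta> (a 1) + \<theta> (\<theta> (a 0)) else 0)" for a :: "nat \<Rightarrow> 'v" and l :: nat
  have E: "E a \<in> tspace 3" "E a 0 = a 0" "E a (Suc 0) = a (Suc 0) + \<theta> (a 0)"
    "E a 2 = a 2 + \<theta> (a (Suc 0))" for a
    by (auto simp: E_def tspace_def)
  have E': "E' a \<in> tspace 3" "E' a 0 = a 0" "E' a (Suc 0) = a (Suc 0) - \<theta> (a 0)"
    "E' a 2 = a 2 - \<theta> (a (Suc 0)) + \<theta> (\<theta> (a 0))" for a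
    by (auto simp: E'_def tspace_def)
  have EE': "E (E' a) = a" if "a \<in> tspace 3" for a
    using that by (intro tspace_3_eqI) (simp_all add: E E' \<theta>_diff)
  have hom: "E (?M a b) = ?M' (E a) (E b)" for a b
    by (rule tspace_3_eqI)
      (simp_all add: tlaw_in_tspace E tlaw_3_coeffs bil \<theta>(1,4) \<psi>'_pair algebra_simps)
  have Eu: "E ?u = ?u"
    by (rule tspace_3_eqI) (simp_all add: E tconst_tspace tconst_coeffs \<theta>(3) \<theta>0)
  have E_gr: "E a \<in> tcomp B 3 g" "E' a \<in> tcomp B 3 g" if "a \<in> tcomp B 3 g" for a g
    using that by (simp_all add: tcomp_3_iff E E' gcomp_closed \<theta>_gr)
  have E_add: "E (a + b) = E a + E b" for a b
    by (auto simp: E_def fun_eq_iff \<theta>(1))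
  have E_zero: "E 0 = 0" using E_add[of 0 0] by simp
  have E_scale: "E (tscale B c a) = tscale B c (E a)" for c a
    by (auto simp: E_def tscale_def fun_eq_iff \<theta>(2) scale_right_distrib)
  have mult: "unital_graded_mult (tspace 3) (tcomp B 3) ?u ?M"
    using second_order_mult_iff[OF \<phi> \<psi>(1)] \<psi>(2) by simp
  have mult': "unital_graded_mult (tspace 3) (tcomp B 3) ?u ?M'"
    unfolding unital_graded_mult_def
  proof (intro conjI allI ballI)
    fix x y z :: "nat \<Rightarrow> 'v" assume x: "x \<in> tspace 3"
    show "?M' ?u x = x" "?M' x ?u = x"
      using mult hom[of ?u "E' x"] hom[of "E' x" ?u] EE'[OF x] E'(1)[of x]
      by (simp_all add: Eu unital_graded_mult_def)
    assume y: "y \<in> tspace 3" and z: "z \<in> tspace 3"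
    have "?M (?M (E' x) (E' y)) (E' z) = ?M (E' x) (?M (E' y) (E' z))"
      using mult E'(1) by (auto simp: unital_graded_mult_def)
    then have "?M' (?M' (E (E' x)) (E (E' y))) (E (E' z)) = ?M' (E (E' x)) (?M' (E (E' y)) (E (E' z)))"
      by (metis hom)
    then show "?M' (?M' x y) z = ?M' x (?M' y z)" using EE' x y z by simp
  next
    fix g h x y assume xy: "x \<in> tcomp B 3 g" "y \<in> tcomp B 3 h"
    then have "E (?M (E' x) (E' y)) \<in> tcomp B 3 (g + h)"
      using mult E_gr by (auto simp: unital_graded_mult_def)
    then show "?M' x y \<in> tcomp B 3 (g + h)" using EE' xy by (simp add: hom tcomp_3_iff)
  qed (use mult in \<open>auto simp: tlaw_in_tspace unital_graded_mult_def\<close>)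
  have "satisfies (\<lambda>c. tscale B (\<iota> c)) (tcomp B 3) ?u ?M' I"
    unfolding satisfies_def
  proof (intro ballI allI impI)
    fix f b assume f: "f \<in> I" and b: "graded_assignment (tcomp B 3) b"
    define a where "a x = E' (b x)" for x
    have a: "graded_assignment (tcomp B 3) a"
      using b E_gr by (auto simp: graded_assignment_def a_def)
    have "b x \<in> tspace 3" for x
      using b by (cases x) (auto simp: graded_assignment_def tcomp_3_iff)
    then have "b x = E (a x)" for x by (simp add: a_def EE')
    then have word: "foldr ?M' (map b w) ?u = E (foldr ?M (map a w) ?u)" for w
      by (induction w) (simp_all add: Eu hom)
    have E_sum: "E (sum F A) = (\<Sum>i\<in>A. E (F i))" for F :: "'g word \<Rightarrow> nat \<Rightarrow> 'v" and A
      by (induction A rule: infinite_finite_induct) (simp_all only: sum.infinite sum.empty sum.insert E_zero E_add not_False_eq_True)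
    have "assoc_eval (\<lambda>c. tscale B (\<iota> c)) ?u ?M' f b = E (assoc_eval (\<lambda>c. tscale B (\<iota> c)) ?u ?M f a)"
      by (simp add: assoc_eval_def word E_sum E_scale)
    also have "\<dots> = 0" using \<psi>(3) f a by (simp add: satisfies_def E_zero)
    finally show "assoc_eval (\<lambda>c. tscale B (\<iota> c)) ?u ?M' f b = 0" .
  qed
  then show ?thesis
    using second_order_lift_iff[OF \<phi>'] second_order_mult_iff[OF \<phi>' \<psi>'] mult' \<psi>' by blast
qed

lemma lift_invariant:
  assumes "\<phi> \<in> cochains B 2" "d_Hoch \<mu> \<phi> = 0" "\<phi>' \<in> cochains B 2" "d_Hoch \<mu> \<phi>' = 0"
    and "first_order_iso B \<mu> \<phi> \<phi>' \<Theta>"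
  shows "(\<exists>M. second_order_lift \<iota> B \<mu> I \<phi> M) \<longleftrightarrow> (\<exists>M. second_order_lift \<iota> B \<mu> I \<phi>' M)"
proof -
  have "infinitesimal_iso \<phi> \<phi>' (\<lambda>x. \<Theta> (tconst x) (Suc 0))"
    using assms by (intro infinitesimal_iso_of_first_order_iso)
  then show ?thesis
    using transport_lift[OF assms(1-4)] transport_lift[OF assms(3,4,1,2)] infinitesimal_iso_minus
    by blast
qed

end

theorem theorem54:
  fixes \<iota> :: "'f::field_char_0 \<Rightarrow> 'k::field"
    and B :: "('g::{group_add,finite}, 'k, 'v::ab_group_add) gspace"
    and \<mu> :: "'v \<Rightarrow> 'v \<Rightarrow> 'v"
    and I :: "('g, 'f) free_alg set"
    and gens :: "('g, 'f) generator list"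
    and \<beta> :: "('g, 'f) free_alg \<Rightarrow> 'g word \<Rightarrow> (nat \<times> 'g) bracketed"
    and \<phi> :: "'v list \<Rightarrow> 'v"
  assumes "field_embedding \<iota>"
    and "graded_T_ideal I"
    and "generating_system I gens"
    and "bracketing \<beta>"
    and "graded_algebra B \<mu>"
    and "satisfies (\<lambda>c. gscale B (\<iota> c)) (gcomp B) (gunit B) \<mu> I"
    and "\<phi> \<in> Z2 \<iota> B \<mu> \<beta> I"
  shows "((\<exists>M. second_order_lift \<iota> B \<mu> I \<phi> M) \<longleftrightarrow>
            (\<exists>\<psi>\<in>cochains B 2. d_Hoch \<mu> \<psi> = - Q_ass \<phi> \<and>
               (\<forall>j<length gens. D_gen \<iota> B \<mu> \<beta> (gens ! j) \<psi> = - Q_gen \<iota> B \<mu> \<beta> (gens ! j) \<phi>))) \<and>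
         ((\<exists>\<psi>\<in>cochains B 2. d_Hoch \<mu> \<psi> = - Q_ass \<phi> \<and>
               (\<forall>j<length gens. D_gen \<iota> B \<mu> \<beta> (gens ! j) \<psi> = - Q_gen \<iota> B \<mu> \<beta> (gens ! j) \<phi>)) \<longleftrightarrow>
            obstruction \<iota> B \<mu> \<beta> gens \<phi> = coker_zero \<iota> B \<mu> \<beta> gens) \<and>
         obstruction \<iota> B \<mu> \<beta> gens \<phi> \<in> coker \<iota> B \<mu> \<beta> gens \<and>
         (\<exists>gens'. generating_system I gens' \<and> \<not> coker_isomorphic \<iota> B \<mu> \<beta> gens gens') \<and>
         (\<forall>gens' \<beta>'. generating_system I gens' \<and> bracketing \<beta>' \<longrightarrow>
            (obstruction \<iota> B \<mu> \<beta> gens \<phi> = coker_zero \<iota> B \<mu> \<beta> gens \<longleftrightarrow>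
             obstruction \<iota> B \<mu> \<beta>' gens' \<phi> = coker_zero \<iota> B \<mu> \<beta>' gens')) \<and>
         (\<forall>\<phi>'\<in>Z2 \<iota> B \<mu> \<beta> I. (\<exists>\<Theta>. first_order_iso B \<mu> \<phi> \<phi>' \<Theta>) \<longrightarrow>
            (obstruction \<iota> B \<mu> \<beta> gens \<phi> = coker_zero \<iota> B \<mu> \<beta> gens \<longleftrightarrow>
             obstruction \<iota> B \<mu> \<beta> gens \<phi>' = coker_zero \<iota> B \<mu> \<beta> gens))"
proof -
  interpret graded_algebra_over \<iota> B \<mu>
    by unfold_locales (fact assms)+
  have gens: "multilinear_generator F" if "F \<in> set gens" for F
    using assms(3) that by (auto simp: generating_system_def)
  have Z2D: "\<chi> \<in> cochains B 2" "d_Hoch \<mu> \<chi> = 0" if "\<chi> \<in> Z2 \<iota> B \<mu> \<beta> I" for \<chi>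
    using that by (auto simp: Z2_def)
  have lift: "(\<exists>M. second_order_lift \<iota> B \<mu> I \<chi> M) \<longleftrightarrow>
      obstruction \<iota> B \<mu> \<beta>' gens' \<chi> = coker_zero \<iota> B \<mu> \<beta>' gens'"
    if "generating_system I gens'" "bracketing \<beta>'" "\<chi> \<in> Z2 \<iota> B \<mu> \<beta> I" for gens' \<beta>' \<chi>
  proof -
    have "\<chi> \<in> Z2 \<iota> B \<mu> \<beta>' I"
      using that(3) Z2_bracketing_independent[OF assms(4) that(2)] by simp
    then show ?thesis
      unfolding obstruction_zero_iff
      by (rule lift_iff_obstruction_equations[OF that(1,2) assms(6)])
  qed
  show ?thesis
  proof (intro conjI)
    show "(\<exists>M. second_order_lift \<iota> B \<mu> I \<phi> M) \<longleftrightarrow>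
      (\<exists>\<psi>\<in>cochains B 2. d_Hoch \<mu> \<psi> = - Q_ass \<phi> \<and>
         (\<forall>j<length gens. D_gen \<iota> B \<mu> \<beta> (gens ! j) \<psi> = - Q_gen \<iota> B \<mu> \<beta> (gens ! j) \<phi>))"
      by (rule lift_iff_obstruction_equations[OF assms(3,4,6,7)])
    show "obstruction \<iota> B \<mu> \<beta> gens \<phi> \<in> coker \<iota> B \<mu> \<beta> gens"
      using gens assms(4) Z2D(1)[OF assms(7)] by (rule obstruction_in_coker)
    show "\<exists>gens'. generating_system I gens' \<and> \<not> coker_isomorphic \<iota> B \<mu> \<beta> gens gens'"
      using generating_system_append_zero[OF assms(3)] coker_depends_on_generators[OF gens assms(4)]
      by blast
    show "\<forall>gens' \<beta>'. generating_system I gens' \<and> bracketing \<beta>' \<longrightarrow>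
      (obstruction \<iota> B \<mu> \<beta> gens \<phi> = coker_zero \<iota> B \<mu> \<beta> gens \<longleftrightarrow>
       obstruction \<iota> B \<mu> \<beta>' gens' \<phi> = coker_zero \<iota> B \<mu> \<beta>' gens')"
      using lift[OF assms(3,4,7)] lift[OF _ _ assms(7)] by blast
    show "\<forall>\<phi>'\<in>Z2 \<iota> B \<mu> \<beta> I. (\<exists>\<Theta>. first_order_iso B \<mu> \<phi> \<phi>' \<Theta>) \<longrightarrow>
      (obstruction \<iota> B \<mu> \<beta> gens \<phi> = coker_zero \<iota> B \<mu> \<beta> gens \<longleftrightarrow>
       obstruction \<iota> B \<mu> \<beta> gens \<phi>' = coker_zero \<iota> B \<mu> \<beta> gens)"
    proof (intro ballI impI)
      fix \<phi>' assume \<phi>': "\<phi>' \<in> Z2 \<iota> B \<mu> \<beta> I" and "\<exists>\<Theta>. first_order_iso B \<mu> \<phi> \<phi>' \<Theta>"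
      then obtain \<Theta> where "first_order_iso B \<mu> \<phi> \<phi>' \<Theta>" by blast
      then show "obstruction \<iota> B \<mu> \<beta> gens \<phi> = coker_zero \<iota> B \<mu> \<beta> gens \<longleftrightarrow>
        obstruction \<iota> B \<mu> \<beta> gens \<phi>' = coker_zero \<iota> B \<mu> \<beta> gens"
        using lift_invariant[OF Z2D[OF assms(7)] Z2D[OF \<phi>']]
        by (simp flip: lift[OF assms(3,4,7)] lift[OF assms(3,4) \<phi>'])
    qed
  qed (rule obstruction_zero_iff[symmetric])
qed

end
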